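(* Let $G$ be a connected graph, $T\subseteq V(G)$ with $|T|$ even, and $M$ an eardrum in $G$ with $V_M\cap T=\emptyset$ and $\mathcal{P}_f\neq\emptyset$ for all $f\in M$. Then $$L_\mu(G,M):=|V(G)|-1+|M|-\mu(G,M)\ \le\ \mathrm{LP}(G,T).$$ In particular, every connected-$T$-join of $G$ has at least $L_\mu(G,M)$ edges.
   Context: Graphs are finite, undirected, may have parallel edges, no loops; $2G$ is $G$ with every edge doubled. A $T$-join in $G$ ($|T|$ even) is $F\subseteq E(G)$ such that $T$ is exactly the set of vertices incident to an odd number of edges of $F$; a connected-$T$-join of $G$ is a $T$-join $F$ in $2G$ with $(V(G),F)$ connected. $\delta(X)$ is the set of edges with exactly one endpoint in $X$; for a partition $\mathcal{W}$ of $V(G)$, $\delta(\mathcal{W})=\bigcup_{W\in\mathcal{W}}\delta(W)$; $x(S)=\sum_{e\in S}x_e$. $\mathrm{LP}(G,T)=\min\{x(E(G)) : x\in\mathbb{R}^{E(G)}_{\ge0},\ x(\delta(W))\ge2 \text{ for all } \emptyset\ne W\subsetneq V(G) \text{ with } |W\cap T| \text{ even},\ x(\delta(\mathcal{W}))\ge|\mathcal{W}|-1 \text{ for all partitions } \mathcal{W} \text{ of } V(G)\}$. An eardrum in $G$ is the set $M$ of vertex sets of connected components of an induced subgraph of $G$ in which every vertex has degree at most 1; $V_M=\bigcup M$. For $f\in M$, $\mathcal{P}_f$ is the set of paths in $G$ whose set of internal vertices is exactly $f$. An earmuff for $M$ in $G$ is a set $\{P_f: f\in F\}$ with $F\subseteq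 M$, $P_f\in\mathcal{P}_f$, such that $(V(G),\bigcup_{f\in F}E(P_f))$ is a forest; its size is $|F|$; $\mu(G,M)$ is the maximum size of an earmuff. *)

theory Defs
  imports "HOL-Analysis.Analysis" "HOL-Library.Disjoint_Sets"
begin

section \<open>Undirected multigraphs\<close>

text \<open>Edges are abstract names, so that parallel edges are distinct edges with the same pair of
  endpoints. The value of \<open>ends\<close> outside the edge set is irrelevant.\<close>

record ('v, 'e) multigraph =
  verts :: "'v set"
  edges :: "'e set"
  ends :: "'e \<Rightarrow> 'v set"

definition fin_multigraph :: "('v, 'e) multigraph \<Rightarrow> bool" where
  "fin_multigraph G \<longleftrightarrow> finite (verts G) \<and> finite (edges G) \<and>
     (\<forall>e\<in>edges G. ends G e \<subseteq> verts G \<and> card (ends G e) = 2)"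

definition doubled :: "('v, 'e) multigraph \<Rightarrow> ('v, 'e \<times> bool) multigraph" where
  "doubled G = \<lparr>verts = verts G, edges = edges G \<times> UNIV, ends = (\<lambda>(e, b). ends G e)\<rparr>"

definition induced :: "('v, 'e) multigraph \<Rightarrow> 'v set \<Rightarrow> ('v, 'e) multigraph" where
  "induced G U = G\<lparr>verts := U, edges := {e \<in> edges G. ends G e \<subseteq> U}\<rparr>"

definition spanning :: "('v, 'e) multigraph \<Rightarrow> 'e set \<Rightarrow> ('v, 'e) multigraph" where
  "spanning G F = G\<lparr>edges := F\<rparr>"

definition vdegree :: "('v, 'e) multigraph \<Rightarrow> 'v \<Rightarrow> nat" where
  "vdegree G v = card {e \<in> edges G. v \<in> ends G e}"

definition adjacent :: "('v, 'e) multigraph \<Rightarrow> 'v \<Rightarrow> 'v \<Rightarrow> bool" where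
  "adjacent G u v \<longleftrightarrow> (\<exists>e\<in>edges G. ends G e = {u, v})"

definition connected_graph :: "('v, 'e) multigraph \<Rightarrow> bool" where
  "connected_graph G \<longleftrightarrow> verts G \<noteq> {} \<and> (\<forall>u\<in>verts G. \<forall>v\<in>verts G. (adjacent G)\<^sup>*\<^sup>* u v)"

definition component_sets :: "('v, 'e) multigraph \<Rightarrow> 'v set set" where
  "component_sets G = {{w \<in> verts G. (adjacent G)\<^sup>*\<^sup>* v w} | v. v \<in> verts G}"

text \<open>A circuit is a cyclic sequence of distinct vertices and distinct edges; two parallel edges
  form a circuit of length 2.\<close>

definition circuit :: "('v, 'e) multigraph \<Rightarrow> 'v list \<Rightarrow> 'e list \<Rightarrow> bool" where
  "circuit G vs es \<longleftrightarrow> 2 \<le> length vs \<and> length es = length vs \<and> distinct vs \<and> distinct es \<and>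
     set vs \<subseteq> verts G \<and> set es \<subseteq> edges G \<and>
     (\<forall>i<length vs. ends G (es ! i) = {vs ! i, vs ! (Suc i mod length vs)})"

definition forest :: "('v, 'e) multigraph \<Rightarrow> bool" where
  "forest G \<longleftrightarrow> (\<nexists>vs es. circuit G vs es)"

text \<open>A path is a pair of its vertex sequence (without repetitions) and its edge sequence.\<close>

definition graph_path :: "('v, 'e) multigraph \<Rightarrow> 'v list \<times> 'e list \<Rightarrow> bool" where
  "graph_path G p \<longleftrightarrow> (case p of (vs, es) \<Rightarrow>
     length vs = Suc (length es) \<and> distinct vs \<and> set vs \<subseteq> verts G \<and> set es \<subseteq> edges G \<and>
     (\<forall>i<length es. ends G (es ! i) = {vs ! i, vs ! Suc i}))"

definition path_edges :: "'v list \<times> 'e list \<Rightarrow> 'e set" where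
  "path_edges p = set (snd p)"

definition internal_verts :: "'v list \<times> 'e list \<Rightarrow> 'v set" where
  "internal_verts p = set (butlast (tl (fst p)))"

definition edge_cut :: "('v, 'e) multigraph \<Rightarrow> 'v set \<Rightarrow> 'e set" where
  "edge_cut G X = {e \<in> edges G. card (ends G e \<inter> X) = 1}"


section \<open>Connected T-joins\<close>

definition T_join :: "('v, 'e) multigraph \<Rightarrow> 'v set \<Rightarrow> 'e set \<Rightarrow> bool" where
  "T_join G T F \<longleftrightarrow> F \<subseteq> edges G \<and>
     T = {v \<in> verts G. odd (card {e \<in> F. v \<in> ends G e})}"

definition connected_T_join :: "('v, 'e) multigraph \<Rightarrow> 'v set \<Rightarrow> ('e \<times> bool) set \<Rightarrow> bool" where
  "connected_T_join G T F \<longleftrightarrow>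
     T_join (doubled G) T F \<and> connected_graph (spanning (doubled G) F)"


section \<open>The linear program\<close>

text \<open>Only the values of \<open>x\<close> on the edge set matter.\<close>

definition LP_feasible :: "('v, 'e) multigraph \<Rightarrow> 'v set \<Rightarrow> ('e \<Rightarrow> real) \<Rightarrow> bool" where
  "LP_feasible G T x \<longleftrightarrow>
     (\<forall>e\<in>edges G. 0 \<le> x e) \<and>
     (\<forall>W. W \<noteq> {} \<and> W \<subset> verts G \<and> even (card (W \<inter> T)) \<longrightarrow> 2 \<le> sum x (edge_cut G W)) \<and>
     (\<forall>\<W>. partition_on (verts G) \<W> \<longrightarrow> real (card \<W>) - 1 \<le> sum x (\<Union>W\<in>\<W>. edge_cut G W))"

text \<open>For connected graphs the infimum is a minimum, see \<open>LP_attained\<close> below.\<close>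

definition LP :: "('v, 'e) multigraph \<Rightarrow> 'v set \<Rightarrow> real" where
  "LP G T = (INF x\<in>{x. LP_feasible G T x}. sum x (edges G))"


section \<open>Eardrums and earmuffs\<close>

definition eardrum :: "('v, 'e) multigraph \<Rightarrow> 'v set set \<Rightarrow> bool" where
  "eardrum G M \<longleftrightarrow> (\<exists>U\<subseteq>verts G.
     (\<forall>v\<in>U. vdegree (induced G U) v \<le> 1) \<and> M = component_sets (induced G U))"

definition paths_through :: "('v, 'e) multigraph \<Rightarrow> 'v set \<Rightarrow> ('v list \<times> 'e list) set" where
  "paths_through G f = {p. graph_path G p \<and> internal_verts p = f}"

text \<open>An earmuff is given as a family of paths indexed by \<open>F\<close>; only the values of \<open>P\<close> on \<open>F\<close>
  matter.\<close>

definition earmuff ::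
    "('v, 'e) multigraph \<Rightarrow> 'v set set \<Rightarrow> 'v set set \<Rightarrow> ('v set \<Rightarrow> 'v list \<times> 'e list) \<Rightarrow> bool" where
  "earmuff G M F P \<longleftrightarrow> F \<subseteq> M \<and> (\<forall>f\<in>F. P f \<in> paths_through G f) \<and>
     forest (spanning G (\<Union>f\<in>F. path_edges (P f)))"

definition mu :: "('v, 'e) multigraph \<Rightarrow> 'v set set \<Rightarrow> nat" where
  "mu G M = Max {card F | F P. earmuff G M F P}"

definition L_mu :: "('v, 'e) multigraph \<Rightarrow> 'v set set \<Rightarrow> int" where
  "L_mu G M = int (card (verts G)) - 1 + int (card M) - int (mu G M)"


section \<open>The linear program attains its minimum\<close>

lemma cut_nonempty:
  assumes G: "fin_multigraph G" "connected_graph G" and W: "W \<noteq> {}" "W \<subset> verts G"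
  shows "edge_cut G W \<noteq> {}"
proof
  assume empty: "edge_cut G W = {}"
  obtain u v where uv: "u \<in> W" "v \<in> verts G" "v \<notin> W" using W by blast
  have "(adjacent G)\<^sup>*\<^sup>* u v" using G(2) uv W by (auto simp: connected_graph_def)
  then have "v \<in> W"
  proof induction
    case base
    show ?case by (fact uv(1))
  next
    case (step y z)
    from step(2) obtain e where e: "e \<in> edges G" "ends G e = {y, z}"
      by (auto simp: adjacent_def)
    show ?case
    proof (rule ccontr)
      assume "z \<notin> W"
      then have "ends G e \<inter> W = {y}" using e step(3) by auto
      then have "e \<in> edge_cut G W" using e by (simp add: edge_cut_def)
      with empty show False by simp
    qed
  qed
  with uv show False by simp
qed

lemma LP_feasible_exists:
  assumes G: "fin_multigraph G" "connected_graph G"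
  shows "\<exists>x. LP_feasible G T x"
proof -
  define c where "c = 2 + real (card (verts G))"
  have fin: "finite (verts G)" "finite (edges G)" using G(1) by (auto simp: fin_multigraph_def)
  have *: "c \<le> sum (\<lambda>_. c) C" if "C \<noteq> {}" "C \<subseteq> edges G" for C
  proof -
    have "1 \<le> card C" using that finite_subset[OF that(2) fin(2)] by (simp add: Suc_le_eq card_gt_0_iff)
    then have "1 * c \<le> real (card C) * c" by (intro mult_right_mono) (auto simp: c_def)
    then show ?thesis by simp
  qed
  have cut: "edge_cut G W \<subseteq> edges G" for W by (auto simp: edge_cut_def)
  have "LP_feasible G T (\<lambda>_. c)" unfolding LP_feasible_def
  proof (intro conjI allI impI ballI)
    show "0 \<le> c" by (simp add: c_def)
  next
    fix W assume "W \<noteq> {} \<and> W \<subset> verts G \<and> even (card (W \<inter> T))"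
    then have "c \<le> sum (\<lambda>_. c) (edge_cut G W)" using cut cut_nonempty[OF G] by (intro *) auto
    moreover have "2 \<le> c" by (simp add: c_def)
    ultimately show "2 \<le> sum (\<lambda>_. c) (edge_cut G W)" by linarith
  next
    fix P assume P: "partition_on (verts G) P"
    have card: "card P \<le> card (verts G)"
    proof -
      have "\<forall>p\<in>P. \<exists>v. v \<in> p" using partition_onD3[OF P] by (metis ex_in_conv)
      then obtain g where g: "\<forall>p\<in>P. g p \<in> p" by metis
      have "inj_on g P" using g partition_onD2[OF P] by (intro inj_onI) (metis IntI disjointD emptyE)
      moreover have "g ` P \<subseteq> verts G" using g partition_onD1[OF P] by auto
      ultimately show ?thesis using card_inj_on_le fin by blast
    qed
    show "real (card P) - 1 \<le> sum (\<lambda>_. c) (\<Union>W\<in>P. edge_cut G W)"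
    proof (cases "card P \<le> 1")
      case True
      then have "real (card P) - 1 \<le> 0" by simp
      also have "0 \<le> sum (\<lambda>_. c) (\<Union>W\<in>P. edge_cut G W)" by (intro sum_nonneg) (simp add: c_def)
      finally show ?thesis .
    next
      case False
      moreover have "finite P" using finite_elements[OF fin(1) P] .
      ultimately obtain p q where pq: "p \<in> P" "q \<in> P" "p \<noteq> q"
        using card_le_Suc0_iff_eq[of P] by auto
      then have "p \<inter> q = {}" "p \<noteq> {}" "q \<noteq> {}"
        using P by (auto simp: partition_on_def disjoint_def)
      moreover have "p \<subseteq> verts G" "q \<subseteq> verts G" using partition_onD1[OF P] pq by auto
      ultimately have "edge_cut G p \<noteq> {}" by (intro cut_nonempty[OF G]) auto
      then have "c \<le> sum (\<lambda>_. c) (\<Union>W\<in>P. edge_cut G W)" using cut pq by (intro *) auto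
      moreover have "real (card P) - 1 \<le> c" using card by (simp add: c_def)
      ultimately show ?thesis by linarith
    qed
  qed
  then show ?thesis by blast
qed

lemma LP_attained:
  assumes G: "fin_multigraph G" "connected_graph G"
  shows "\<exists>x. LP_feasible G T x \<and> sum x (edges G) = LP G T \<and>
    (\<forall>y. LP_feasible G T y \<longrightarrow> LP G T \<le> sum y (edges G))"
proof -
  let ?E = "edges G"
  have finE: "finite ?E" using G(1) by (simp add: fin_multigraph_def)
  have cut: "edge_cut G W \<subseteq> ?E" for W by (auto simp: edge_cut_def)
  obtain x0 where x0: "LP_feasible G T x0" using LP_feasible_exists[OF G] by blast
  define b where "b = sum x0 ?E"
  define r where "r = (\<lambda>(x :: 'b \<Rightarrow> real) e. if e \<in> ?E then x e else 0)"
  define B where "B = PiE UNIV (\<lambda>e. if e \<in> ?E then {0..b} else {0 :: real})"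
  define K where "K = B \<inter> {x. LP_feasible G T x}"
  have sum_r: "sum (r x) C = sum x C" if "C \<subseteq> ?E" for x C
    using that by (intro sum.cong) (auto simp: r_def)
  have feas_r: "LP_feasible G T (r x)" if "LP_feasible G T x" for x
  proof -
    have "sum (r x) (edge_cut G W) = sum x (edge_cut G W)"
         "sum (r x) (\<Union>W\<in>\<W>. edge_cut G W) = sum x (\<Union>W\<in>\<W>. edge_cut G W)" for W \<W>
      by (intro sum_r, use cut in blast)+
    then show ?thesis using that by (simp add: LP_feasible_def r_def)
  qed
  have in_K: "r x \<in> K" if x: "LP_feasible G T x" "sum x ?E \<le> b" for x
  proof -
    have nn: "\<forall>e\<in>?E. 0 \<le> x e" using x by (simp add: LP_feasible_def)
    have "x e \<le> b" if "e \<in> ?E" for e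
      using member_le_sum[OF that, of x] nn finE x(2) by fastforce
    then show ?thesis using nn feas_r[OF x(1)] by (auto simp: K_def B_def r_def)
  qed
  have "compact B"
  proof -
    have "compactin (product_topology (\<lambda>_. euclidean) UNIV) B"
      unfolding B_def by (subst compactin_PiE) auto
    then show ?thesis by (simp add: euclidean_product_topology)
  qed
  moreover have "closed {x. LP_feasible G T x}"
  proof -
    have cont: "continuous_on UNIV (\<lambda>x :: 'b \<Rightarrow> real. sum x C)" for C
      by (intro continuous_on_sum continuous_on_product_coordinates)
    have [intro]: "closed {x :: 'b \<Rightarrow> real. a \<le> sum x C}" for a C
      by (intro closed_Collect_le continuous_on_const cont)
    have "closed {x :: 'b \<Rightarrow> real. 0 \<le> x e}" for e
      by (intro closed_Collect_le continuous_on_const continuous_on_product_coordinates)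
    moreover have "{x. LP_feasible G T x} = (\<Inter>e\<in>?E. {x. 0 \<le> x e}) \<inter>
      (\<Inter>W\<in>{W. W \<noteq> {} \<and> W \<subset> verts G \<and> even (card (W \<inter> T))}. {x. 2 \<le> sum x (edge_cut G W)}) \<inter>
      (\<Inter>\<W>\<in>{\<W>. partition_on (verts G) \<W>}.
        {x. real (card \<W>) - 1 \<le> sum x (\<Union>W\<in>\<W>. edge_cut G W)})"
      unfolding LP_feasible_def by blast
    ultimately show ?thesis by (auto intro!: closed_Int closed_INT)
  qed
  ultimately have "compact K" by (simp add: K_def compact_Int_closed)
  moreover have "K \<noteq> {}" using in_K[OF x0] b_def by auto
  moreover have "continuous_on K (\<lambda>x. sum x ?E)"
    by (intro continuous_on_sum continuous_on_subset[OF continuous_on_product_coordinates]) auto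
  ultimately obtain x where x: "x \<in> K" "\<forall>y\<in>K. sum x ?E \<le> sum y ?E"
    using continuous_attains_inf[of K "\<lambda>x. sum x ?E"] by auto
  have fx: "LP_feasible G T x" using x by (simp add: K_def)
  have min: "sum x ?E \<le> sum y ?E" if y: "LP_feasible G T y" for y
  proof (cases "sum y ?E \<le> b")
    case True
    then show ?thesis using x(2) in_K[OF y] sum_r[of ?E y] by fastforce
  next
    case False
    have "sum x ?E \<le> sum (r x0) ?E" using x(2) in_K[OF x0] b_def by blast
    then show ?thesis using False sum_r[of ?E x0] b_def by simp
  qed
  have "LP G T = sum x ?E" unfolding LP_def
  proof (rule cInf_eq_minimum)
    show "sum x ?E \<in> (\<lambda>x. sum x ?E) ` {x. LP_feasible G T x}" using fx by blast
  qed (use min in auto)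
  with fx min show ?thesis by auto
qed

end

theory Submission
  imports Defs
begin

text \<open>Every path through \<open>f \<in> M\<close> joins two vertices outside \<open>\<Union>M\<close>, and choosing paths that
  form a forest amounts to choosing terminal pairs that are independent in the graphic matroid on
  \<open>V(G) - \<Union>M\<close>. Rado's theorem in its deficiency version yields \<open>M' \<subseteq> M\<close> with
  \<open>\<mu>(G, M) \<ge> r(M') + |M - M'|\<close>, where \<open>r(M')\<close> is the rank of all terminal pairs of elements of
  \<open>M'\<close>. The neighbours of an element of \<open>M'\<close> all lie in one class of the induced partition of
  \<open>V(G) - \<Union>M\<close>. Merging the elements of \<open>M'\<close> into their classes and taking the other vertices of
  \<open>\<Union>M\<close> as singletons gives a partition constraint; the edges incident to \<open>f \<in> M'\<close> are not
  counted in it and have weight at least \<open>|f| + 1\<close> by the cut constraints. The sum of these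
  inequalities is the bound. The edge multiplicities of a connected \<open>T\<close>-join are feasible.\<close>

section \<open>Rado's theorem for rank functions\<close>

text \<open>Matroid rank functions, axiomatised by the increment that one new element causes. In
  this local form the axioms can be checked directly for graphs, where each increment is 0 or
  1.\<close>

locale rank_function =
  fixes E :: "'a set" and r :: "'a set \<Rightarrow> nat"
  assumes finite_ground: "finite E"
    and rank_empty: "r {} = 0"
    and rank_insert_le: "X \<subseteq> E \<Longrightarrow> a \<in> E \<Longrightarrow> r (insert a X) \<le> Suc (r X)"
    and rank_le_insert: "X \<subseteq> E \<Longrightarrow> a \<in> E \<Longrightarrow> r X \<le> r (insert a X)"
    and diminishing: "X \<subseteq> Y \<Longrightarrow> Y \<subseteq> E \<Longrightarrow> a \<in> E \<Longrightarrow>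
      r (insert a Y) + r X \<le> r (insert a X) + r Y"
begin

lemma finite_sub: "X \<subseteq> E \<Longrightarrow> finite X"
  using finite_ground finite_subset by blast

lemma rank_le_card:
  assumes "X \<subseteq> E"
  shows "r X \<le> card X"
proof -
  have "finite X" using assms by (rule finite_sub)
  then show ?thesis using assms
  proof induction
    case (insert a X)
    then show ?case using rank_insert_le[of X a] by simp
  qed (simp add: rank_empty)
qed

lemma rank_mono:
  assumes "X \<subseteq> Y" "Y \<subseteq> E"
  shows "r X \<le> r Y"
proof -
  have "r X \<le> r (X \<union> Z)" if "Z \<subseteq> E" for Z
  proof -
    have "finite Z" using that by (rule finite_sub)
    then show ?thesis using that
    proof induction
      case (insert z Z)
      have "r (X \<union> Z) \<le> r (insert z (X \<union> Z))"
        using insert assms by (intro rank_le_insert) auto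
      then show ?case using insert by simp
    qed simp
  qed
  from this[OF assms(2)] assms(1) show ?thesis by (simp add: Un_absorb1)
qed

text \<open>The elements of \<open>Y\<close> are added one at a time to \<open>X\<close> and to
  \<open>X \<inter> Y\<close> in parallel; by \<open>diminishing\<close> the larger set gains no
  more at any step.\<close>

lemma submodular:
  assumes "X \<subseteq> E" "Y \<subseteq> E"
  shows "r (X \<union> Y) + r (X \<inter> Y) \<le> r X + r Y"
proof -
  have "r (X \<union> Z) + r (X \<inter> Y) \<le> r (X \<inter> Y \<union> Z) + r X" if "Z \<subseteq> E" for Z
  proof -
    have "finite Z" using that by (rule finite_sub)
    then show ?thesis using that
    proof induction
      case (insert a Z)
      have "r (insert a (X \<union> Z)) + r (X \<inter> Y \<union> Z) \<le> r (insert a (X \<inter> Y \<union> Z)) + r (X \<union> Z)"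
        using insert assms by (intro diminishing) auto
      then show ?case using insert by simp
    qed simp
  qed
  from this[OF assms(2)] show ?thesis by (simp add: Un_absorb1)
qed

text \<open>Greedy construction: by \<open>diminishing\<close>, an element that raises the rank of
  \<open>X\<close> also raises the rank of the current \<open>B \<subseteq> X\<close>, so
  \<open>B\<close> can be extended by it.\<close>

lemma basis_exists:
  assumes "X \<subseteq> E"
  shows "\<exists>B\<subseteq>X. r B = card B \<and> r B = r X"
proof -
  have "finite X" using assms by (rule finite_sub)
  then show ?thesis using assms
  proof induction
    case empty
    then show ?case using rank_empty by auto
  next
    case (insert a X)
    then obtain B where B: "B \<subseteq> X" "r B = card B" "r B = r X" by auto
    show ?case
    proof (cases "r (insert a X) = r X")
      case True
      then show ?thesis using B by (intro exI[of _ B]) auto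
    next
      case False
      then have X: "r (insert a X) = Suc (r X)"
        using rank_insert_le[of X a] rank_le_insert[of X a] insert.prems by auto
      have "B \<subseteq> E" using B insert.prems by auto
      then have "r (insert a B) \<le> Suc (r B)" using rank_insert_le insert.prems by auto
      moreover have "r (insert a X) + r B \<le> r (insert a B) + r X"
        using B insert.prems by (intro diminishing) auto
      ultimately have "r (insert a B) = Suc (r B)" using X by simp
      moreover have "card (insert a B) = Suc (card B)"
        using B insert.hyps \<open>B \<subseteq> E\<close> finite_sub by (subst card_insert_disjoint) auto
      ultimately show ?thesis using B X by (intro exI[of _ "insert a B"]) auto
    qed
  qed
qed

text \<open>If some \<open>A f\<close> contains two elements, then one of them can be removed without
  violating the rank condition: otherwise submodularity applied to two violating subfamilies
  yields a contradiction.\<close>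

theorem Rado:
  assumes "finite M" and "\<And>f. f \<in> M \<Longrightarrow> A f \<subseteq> E"
    and "\<And>M'. M' \<subseteq> M \<Longrightarrow> k \<le> r (\<Union>(A ` M')) + card (M - M')"
  shows "\<exists>F a. F \<subseteq> M \<and> (\<forall>f\<in>F. a f \<in> A f) \<and> inj_on a F \<and> k \<le> card F \<and> r (a ` F) = card F"
  using assms(2,3)
proof (induction "\<Sum>f\<in>M. card (A f)" arbitrary: A rule: less_induct)
  case less
  note AE = less.prems(1) and cond = less.prems(2)
  have UE: "\<Union>(A ` N) \<subseteq> E" if "N \<subseteq> M" for N using AE that by blast
  show ?case
  proof (cases "\<exists>f\<in>M. \<exists>a\<in>A f. \<exists>b\<in>A f. a \<noteq> b")
    case False
    \<comment> \<open>Every \<open>A f\<close> has at most one element here, so a basis of the union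
      is already a system of representatives: \<open>g\<close> assigns to each basis element a set
      containing it and is injective, and its inverse is the desired choice. The bound on
      \<open>k\<close> is the hypothesis for the whole family.\<close>
    obtain B where B: "B \<subseteq> \<Union>(A ` M)" "r B = card B" "r B = r (\<Union>(A ` M))"
      using basis_exists[OF UE[OF order.refl]] by auto
    then obtain g where g: "\<And>b. b \<in> B \<Longrightarrow> g b \<in> M \<and> b \<in> A (g b)" by (meson UN_E subsetD)
    have inj: "inj_on g B"
    proof (rule inj_onI)
      fix b c assume "b \<in> B" "c \<in> B" "g b = g c"
      then show "b = c" using g[of b] g[of c] False by auto
    qed
    have "k \<le> card B" using cond[of M] B by simp
    moreover have "inv_into B g ` g ` B = B" using inj by simp
    moreover have "inj_on (inv_into B g) (g ` B)" by (rule inj_on_inv_into) simp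
    moreover have "card (g ` B) = card B" using inj by (rule card_image)
    moreover have "inv_into B g f \<in> A f" if "f \<in> g ` B" for f
      using that inj g by auto
    moreover have "g ` B \<subseteq> M" using g by auto
    ultimately show ?thesis using B(2)
      by (intro exI[of _ "g ` B"] exI[of _ "inv_into B g"]) simp
  next
    case True
    then obtain f a b where f: "f \<in> M" "a \<in> A f" "b \<in> A f" "a \<noteq> b" by blast
    have fin: "finite (A f)" using AE[OF f(1)] by (rule finite_sub)
    have reduce: "\<exists>F a. F \<subseteq> M \<and> (\<forall>f\<in>F. a f \<in> A f) \<and> inj_on a F \<and> k \<le> card F \<and> r (a ` F) = card F"
      if c: "c \<in> A f"
        and ok: "\<And>M'. M' \<subseteq> M \<Longrightarrow> k \<le> r (\<Union>((A(f := A f - {c})) ` M')) + card (M - M')" for c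
    proof -
      let ?A = "A(f := A f - {c})"
      have split: "(\<Sum>g\<in>M. card (h g)) = card (h f) + (\<Sum>g\<in>M-{f}. card (h g))" for h :: "_ \<Rightarrow> 'a set"
        using assms(1) f(1) by (rule sum.remove)
      have "card (?A f) < card (A f)" using card_Diff1_less[OF fin c] by simp
      moreover have "(\<Sum>g\<in>M-{f}. card (?A g)) = (\<Sum>g\<in>M-{f}. card (A g))"
        by (intro sum.cong) auto
      ultimately have "(\<Sum>g\<in>M. card (?A g)) < (\<Sum>g\<in>M. card (A g))"
        using split[of A] split[of ?A] by linarith
      then have "\<exists>F a. F \<subseteq> M \<and> (\<forall>f\<in>F. a f \<in> ?A f) \<and> inj_on a F \<and> k \<le> card F \<and> r (a ` F) = card F"
      proof (rule less.hyps)
        show "?A g \<subseteq> E" if "g \<in> M" for g using AE[OF that] by auto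
      qed (rule ok)
      then obtain F h where F: "F \<subseteq> M" "\<forall>f\<in>F. h f \<in> ?A f" "inj_on h F" "k \<le> card F"
          "r (h ` F) = card F"
        by (elim exE conjE)
      from F(2) have "\<forall>f\<in>F. h f \<in> A f" by (auto split: if_splits)
      with F show ?thesis by (intro exI[of _ F] exI[of _ h]) simp
    qed
    \<comment> \<open>Only \<open>A f\<close> has changed, so a violating subfamily must contain
      \<open>f\<close>; it is written as \<open>insert f N\<close>.\<close>
    have violated: "\<exists>N\<subseteq>M - {f}. r (\<Union>(A ` N) \<union> (A f - {c})) + card (M - insert f N) < k"
      if "M' \<subseteq> M" "\<not> k \<le> r (\<Union>((A(f := A f - {c})) ` M')) + card (M - M')" for M' c
    proof -
      have "f \<in> M'"
      proof (rule ccontr)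
        assume "f \<notin> M'"
        then have "(A(f := A f - {c})) ` M' = A ` M'" by auto
        then show False using that cond[of M'] by simp
      qed
      then have "\<Union>((A(f := A f - {c})) ` M') = \<Union>(A ` (M' - {f})) \<union> (A f - {c})"
        by (auto split: if_splits)
      moreover have "insert f (M' - {f}) = M'" using \<open>f \<in> M'\<close> by auto
      ultimately have "r (\<Union>(A ` (M' - {f})) \<union> (A f - {c})) + card (M - insert f (M' - {f})) < k"
        using that by simp
      then show ?thesis using that(1) by (intro exI[of _ "M' - {f}"]) auto
    qed
    show ?thesis
    proof (rule ccontr)
      assume no: "\<not> ?thesis"
      have ex: "\<exists>N\<subseteq>M - {f}. r (\<Union>(A ` N) \<union> (A f - {c})) + card (M - insert f N) < k"
        if "c \<in> A f" for c
      proof (rule ccontr)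
        assume "\<not> ?thesis"
        then have "k \<le> r (\<Union>((A(f := A f - {c})) ` M')) + card (M - M')" if "M' \<subseteq> M" for M'
          using violated[OF that] by blast
        from reduce[OF \<open>c \<in> A f\<close> this] no show False by contradiction
      qed
      obtain N1 where N1: "N1 \<subseteq> M - {f}"
          "r (\<Union>(A ` N1) \<union> (A f - {a})) + card (M - insert f N1) < k"
        using ex[OF f(2)] by blast
      obtain N2 where N2: "N2 \<subseteq> M - {f}"
          "r (\<Union>(A ` N2) \<union> (A f - {b})) + card (M - insert f N2) < k"
        using ex[OF f(3)] by blast
      let ?X = "\<Union>(A ` N1) \<union> (A f - {a})" and ?Y = "\<Union>(A ` N2) \<union> (A f - {b})"
      have XY: "?X \<subseteq> E" "?Y \<subseteq> E" using UE[of N1] UE[of N2] N1 N2 AE[OF f(1)] by auto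
      \<comment> \<open>Because \<open>a \<noteq> b\<close>, each of the two deleted elements
        survives in the other set, so the union recovers all of \<open>A f\<close>.\<close>
      have un: "?X \<union> ?Y = \<Union>(A ` (insert f (N1 \<union> N2)))" using f by auto
      have "\<Union>(A ` (N1 \<inter> N2)) \<subseteq> ?X \<inter> ?Y" by auto
      then have "r (\<Union>(A ` (N1 \<inter> N2))) \<le> r (?X \<inter> ?Y)" using XY by (intro rank_mono) auto
      moreover have "r (?X \<union> ?Y) + r (?X \<inter> ?Y) \<le> r ?X + r ?Y" using XY by (rule submodular)
      moreover have "k \<le> r (\<Union>(A ` (insert f (N1 \<union> N2)))) + card (M - insert f (N1 \<union> N2))"
        using N1 N2 f by (intro cond) auto
      moreover have "k \<le> r (\<Union>(A ` (N1 \<inter> N2))) + card (M - (N1 \<inter> N2))"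
        using N1 by (intro cond) auto
      \<comment> \<open>The extra 1 counts \<open>f\<close>, which lies outside
        \<open>N1 \<inter> N2\<close> but in neither complement on the left. The two strict
        violations lose 2 in total, the hypothesis for the union and the intersection permits a loss
        of only 1.\<close>
      moreover have "card (M - insert f N1) + card (M - insert f N2) + 1
          = card (M - insert f (N1 \<union> N2)) + card (M - (N1 \<inter> N2))"
      proof -
        have "card (M - insert f N1) + card (M - insert f N2)
            = card ((M - insert f N1) \<union> (M - insert f N2)) + card ((M - insert f N1) \<inter> (M - insert f N2))"
          using assms(1) by (intro card_Un_Int) auto
        moreover have "(M - insert f N1) \<inter> (M - insert f N2) = M - insert f (N1 \<union> N2)" by auto
        moreover have "M - (N1 \<inter> N2) = insert f ((M - insert f N1) \<union> (M - insert f N2))"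
          using f N1 by auto
        moreover have "card (insert f ((M - insert f N1) \<union> (M - insert f N2)))
            = Suc (card ((M - insert f N1) \<union> (M - insert f N2)))"
          using assms(1) by (intro card_insert_disjoint) auto
        ultimately show ?thesis by simp
      qed
      ultimately show False using N1(2) N2(2) unfolding un by linarith
    qed
  qed
qed

end


section \<open>The graphic rank function\<close>

text \<open>Connectivity in the graph with edge set \<open>X\<close>; the orientation of the pairs
  is immaterial. The relation lives on the whole type, so it is an equivalence without reference to
  a vertex set.\<close>

definition conn :: "('a \<times> 'a) set \<Rightarrow> ('a \<times> 'a) set" where
  "conn X = (X \<union> X\<inverse>)\<^sup>*"

lemma conn_refl [simp]: "(u, u) \<in> conn X"
  by (simp add: conn_def)

lemma conn_sym: "(u, v) \<in> conn X \<Longrightarrow> (v, u) \<in> conn X"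
  unfolding conn_def by (meson sym_Un_converse sym_rtrancl symE)

lemma conn_trans: "(u, v) \<in> conn X \<Longrightarrow> (v, w) \<in> conn X \<Longrightarrow> (u, w) \<in> conn X"
  unfolding conn_def by (rule rtrancl_trans)

lemma conn_mono: "X \<subseteq> Y \<Longrightarrow> conn X \<subseteq> conn Y"
  unfolding conn_def by (intro rtrancl_mono) auto

lemma conn_edge: "(u, v) \<in> X \<Longrightarrow> (u, v) \<in> conn X"
  by (auto simp: conn_def)

lemma equiv_conn: "equiv UNIV (conn X)"
  by (intro equivI refl_onI symI transI) (auto intro: conn_sym conn_trans)

lemma conn_minimal:
  assumes "X \<subseteq> R" "refl R" "sym R" "trans R"
  shows "conn X \<subseteq> R"
proof
  fix p assume "p \<in> conn X"
  then obtain u v where p: "p = (u, v)" "(u, v) \<in> (X \<union> X\<inverse>)\<^sup>*" by (cases p) (auto simp: conn_def)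
  from p(2) have "(u, v) \<in> R"
  proof induction
    case base
    show ?case using assms by (simp add: refl_onD)
  next
    case (step v w)
    have "(v, w) \<in> R" using step(2) assms by (auto dest: symD)
    with step show ?case using assms by (blast dest: transD)
  qed
  with p show "p \<in> R" by simp
qed

lemma conn_empty: "conn {} = Id"
  by (simp add: conn_def)

lemma conn_insert_redundant:
  assumes "(a, b) \<in> conn X"
  shows "conn (insert (a, b) X) = conn X"
proof
  show "conn (insert (a, b) X) \<subseteq> conn X"
    using equiv_conn[of X] assms conn_edge
    by (intro conn_minimal) (auto simp: equiv_def)
qed (intro conn_mono, blast)

text \<open>A new edge merges the classes of its ends. The right-hand side is transitive because the
  union of these two classes is closed under \<open>conn X\<close>.\<close>

lemma conn_insert:
  "conn (insert (a, b) X) = conn X \<union> (conn X `` {a, b}) \<times> (conn X `` {a, b})" (is "_ = ?R")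
proof
  show "conn (insert (a, b) X) \<subseteq> ?R"
  proof (rule conn_minimal)
    show "refl ?R" by (auto intro!: refl_onI)
    show "sym ?R" by (auto intro!: symI intro: conn_sym)
    have "u \<in> conn X `` {a, b} \<longleftrightarrow> v \<in> conn X `` {a, b}" if "(u, v) \<in> conn X" for u v
      using that by (blast intro: conn_sym conn_trans)
    then show "trans ?R" by (intro transI) (blast intro: conn_trans)
    have "a \<in> conn X `` {a, b}" "b \<in> conn X `` {a, b}"
      using conn_refl[of a X] conn_refl[of b X] by blast+
    moreover have "X \<subseteq> conn X" using conn_edge by (rule subrelI)
    ultimately show "insert (a, b) X \<subseteq> ?R" by auto
  qed
  have 1: "conn X \<subseteq> conn (insert (a, b) X)" by (intro conn_mono) auto
  moreover have "(a, b) \<in> conn (insert (a, b) X)" by (intro conn_edge) simp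
  ultimately have "(a, u) \<in> conn (insert (a, b) X)" if "u \<in> conn X `` {a, b}" for u
    using that conn_trans[of a b "insert (a, b) X" u] by blast
  then have "conn X `` {a, b} \<times> conn X `` {a, b} \<subseteq> conn (insert (a, b) X)"
    using conn_sym[of a _ "insert (a, b) X"] conn_trans[of _ a "insert (a, b) X"] by blast
  with 1 show "?R \<subseteq> conn (insert (a, b) X)" by (rule Un_least)
qed

text \<open>Two distinct classes are replaced by their union, which was not a class before; all
  other classes survive.\<close>

lemma card_quotient_conn_insert:
  assumes "finite V" "a \<in> V" "b \<in> V" "(a, b) \<notin> conn X"
  shows "Suc (card (V // conn (insert (a, b) X))) = card (V // conn X)"
proof -
  let ?c = "\<lambda>v. conn X `` {v}"
  have fin: "finite (V // conn X)" using assms(1) by (simp add: quotient_def)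
  have cls: "?c u = ?c v \<longleftrightarrow> (u, v) \<in> conn X" for u v
    using equiv_class_eq_iff[OF equiv_conn, of u v X] by auto
  have new: "conn (insert (a, b) X) `` {v} =
      (if (a, v) \<in> conn X \<or> (b, v) \<in> conn X then ?c a \<union> ?c b else ?c v)" for v
  proof -
    have "?c v \<subseteq> ?c a \<union> ?c b" if "(a, v) \<in> conn X \<or> (b, v) \<in> conn X"
      using that conn_trans[of a v X] conn_trans[of b v X] by blast
    then show ?thesis unfolding conn_insert by auto
  qed
  have "V // conn (insert (a, b) X) = insert (?c a \<union> ?c b) (V // conn X - {?c a, ?c b})"
  proof (intro equalityI subsetI)
    fix C assume "C \<in> V // conn (insert (a, b) X)"
    then obtain v where "v \<in> V" "C = conn (insert (a, b) X) `` {v}" by (auto elim: quotientE)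
    then show "C \<in> insert (?c a \<union> ?c b) (V // conn X - {?c a, ?c b})"
      unfolding new by (auto simp: cls quotientI intro: conn_sym)
  next
    fix C assume "C \<in> insert (?c a \<union> ?c b) (V // conn X - {?c a, ?c b})"
    then consider "C = ?c a \<union> ?c b" | v where "v \<in> V" "C = ?c v" "C \<noteq> ?c a" "C \<noteq> ?c b"
      by (blast elim!: quotientE)
    then show "C \<in> V // conn (insert (a, b) X)"
    proof cases
      case 1
      then have "C = conn (insert (a, b) X) `` {a}" unfolding new by simp
      then show ?thesis using assms by (simp add: quotientI)
    next
      case 2
      then have "C = conn (insert (a, b) X) `` {v}" unfolding new using cls conn_sym by metis
      then show ?thesis using 2 by (simp add: quotientI)
    qed
  qed
  moreover have "?c a \<union> ?c b \<notin> V // conn X"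
  proof
    assume "?c a \<union> ?c b \<in> V // conn X"
    then obtain v where v: "?c a \<union> ?c b = ?c v" by (auto elim: quotientE)
    have "a \<in> ?c a \<union> ?c b" "b \<in> ?c a \<union> ?c b" by auto
    then have "(v, a) \<in> conn X" "(v, b) \<in> conn X" unfolding v by auto
    then show False using assms(4) by (blast intro: conn_sym conn_trans)
  qed
  moreover have "?c a \<noteq> ?c b" using assms(4) cls by simp
  moreover have "?c a \<in> V // conn X" "?c b \<in> V // conn X" using assms by (auto intro: quotientI)
  ultimately have "card (V // conn (insert (a, b) X)) = Suc (card (V // conn X - {?c a, ?c b}))"
    using fin by simp
  moreover have "card (V // conn X - {?c a, ?c b}) = card (V // conn X) - 2"
    using fin \<open>?c a \<noteq> ?c b\<close> \<open>?c a \<in> _\<close> \<open>?c b \<in> _\<close> by (subst card_Diff_subset) auto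
  moreover have "2 \<le> card (V // conn X)"
    using card_mono[OF fin, of "{?c a, ?c b}"] \<open>?c a \<noteq> ?c b\<close> \<open>?c a \<in> _\<close> \<open>?c b \<in> _\<close> by simp
  ultimately show ?thesis by simp
qed

lemma card_quotient_le: "finite V \<Longrightarrow> card (V // R) \<le> card V"
proof -
  have "V // R = (\<lambda>v. R `` {v}) ` V" by (auto simp: quotient_def)
  then show "finite V \<Longrightarrow> card (V // R) \<le> card V" by (simp add: card_image_le)
qed

text \<open>The number of edges of a spanning forest: vertices minus components. For finite
  \<open>V\<close> the natural subtraction does not truncate.\<close>

definition graphic_rank :: "'a set \<Rightarrow> ('a \<times> 'a) set \<Rightarrow> nat" where
  "graphic_rank V X = card V - card (V // conn X)"

lemma graphic_rank_add: "finite V \<Longrightarrow> graphic_rank V X + card (V // conn X) = card V"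
  using card_quotient_le[of V "conn X"] by (simp add: graphic_rank_def)

lemma graphic_rank_insert:
  assumes "finite V" "a \<in> V" "b \<in> V"
  shows "graphic_rank V (insert (a, b) X) = graphic_rank V X + (if (a, b) \<in> conn X then 0 else 1)"
  using conn_insert_redundant[of a b X] card_quotient_conn_insert[OF assms, of X]
    graphic_rank_add[OF assms(1), of X] graphic_rank_add[OF assms(1), of "insert (a, b) X"]
  by auto

text \<open>An edge raises the rank exactly when its ends are not yet connected. Connectivity only
  grows with the edge set, so increments diminish.\<close>

lemma rank_function_graphic_rank:
  assumes "finite V"
  shows "rank_function (V \<times> V) (graphic_rank V)"
proof
  have "card (V // Id) = card V"
  proof -
    have "V // Id = (\<lambda>v. {v}) ` V" by (auto simp: quotient_def)
    then show ?thesis by (simp add: card_image)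
  qed
  then show "graphic_rank V {} = 0" by (simp add: graphic_rank_def conn_empty)
  fix X Y :: "('a \<times> 'a) set" and a assume "X \<subseteq> Y" "a \<in> V \<times> V"
  then show "graphic_rank V (insert a Y) + graphic_rank V X
      \<le> graphic_rank V (insert a X) + graphic_rank V Y"
    using assms conn_mono[of X Y] by (cases a) (auto simp: graphic_rank_insert)
qed (use assms in \<open>auto simp: graphic_rank_insert\<close>)

lemma graphic_rank_le_card:
  assumes "finite V" "X \<subseteq> V \<times> V"
  shows "graphic_rank V X \<le> card X"
proof -
  interpret rank_function "V \<times> V" "graphic_rank V"
    using assms(1) by (rule rank_function_graphic_rank)
  show ?thesis using assms(2) by (rule rank_le_card)
qed

text \<open>If the ends stayed connected after the deletion, the rank would not drop, although the
  remaining set has fewer than \<open>card X\<close> elements.\<close>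

lemma independent_bridge:
  assumes "finite V" "X \<subseteq> V \<times> V" "graphic_rank V X = card X" "(a, b) \<in> X"
  shows "(a, b) \<notin> conn (X - {(a, b)})"
proof
  assume "(a, b) \<in> conn (X - {(a, b)})"
  moreover have "insert (a, b) (X - {(a, b)}) = X" using assms(4) by auto
  ultimately have "graphic_rank V X = graphic_rank V (X - {(a, b)})"
    using graphic_rank_insert[of V a b "X - {(a, b)}"] assms by auto
  also have "\<dots> \<le> card (X - {(a, b)})" using assms by (intro graphic_rank_le_card) auto
  also have "\<dots> < card X" using assms finite_subset[OF assms(2)] by (intro card_Diff1_less) auto
  finally show False using assms(3) by simp
qed


section \<open>Bridges and forests\<close>

definition splits :: "'v set \<Rightarrow> 'v set \<Rightarrow> bool" where
  "splits S A \<longleftrightarrow> A \<inter> S \<noteq> {} \<and> \<not> A \<subseteq> S"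

lemma splits_pair: "splits S {u, v} \<longleftrightarrow> (u \<in> S) \<noteq> (v \<in> S)"
  by (auto simp: splits_def)

text \<open>A circuit cannot cross a cut exactly once: if its first edge is the only crossing edge,
  then following the remaining edges back to the start never changes sides.\<close>

lemma forestI_bridges:
  assumes "\<And>e. e \<in> edges G \<Longrightarrow>
    \<exists>S. splits S (ends G e) \<and> (\<forall>e'\<in>edges G. splits S (ends G e') \<longrightarrow> e' = e)"
  shows "forest G"
  unfolding forest_def
proof (intro notI, elim exE)
  fix vs es assume "circuit G vs es"
  then have c: "2 \<le> length vs" "length es = length vs" "distinct es" "set es \<subseteq> edges G"
      "\<And>i. i < length vs \<Longrightarrow> ends G (es ! i) = {vs ! i, vs ! (Suc i mod length vs)}"
    by (auto simp: circuit_def)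
  have E: "es ! i \<in> edges G" if "i < length vs" for i
    using that c nth_mem[of i es] by auto
  obtain S where S: "splits S (ends G (es ! 0))"
      "\<And>e'. e' \<in> edges G \<Longrightarrow> splits S (ends G e') \<Longrightarrow> e' = es ! 0"
    using assms[OF E[of 0]] c by fastforce
  have other: "vs ! i \<in> S \<longleftrightarrow> vs ! (Suc i mod length vs) \<in> S" if "0 < i" "i < length vs" for i
  proof -
    have "es ! i \<noteq> es ! 0" using that c(2) nth_eq_iff_index_eq[OF c(3), of i 0] by fastforce
    then have "\<not> splits S (ends G (es ! i))" using S(2) E that by blast
    then show ?thesis using c(5) that by (simp add: splits_pair)
  qed
  have along: "Suc i < length vs \<Longrightarrow> vs ! Suc i \<in> S \<longleftrightarrow> vs ! 1 \<in> S" for i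
  proof (induction i)
    case (Suc i)
    then show ?case using other[of "Suc i"] by simp
  qed simp
  obtain n where n: "length vs = Suc (Suc n)" using c(1) by (metis add_2_eq_Suc le_Suc_ex)
  have "vs ! Suc n \<in> S \<longleftrightarrow> vs ! 0 \<in> S" using other[of "Suc n"] n by simp
  moreover have "vs ! Suc n \<in> S \<longleftrightarrow> vs ! 1 \<in> S" using along[of n] n by simp
  moreover have "(vs ! 0 \<in> S) \<noteq> (vs ! 1 \<in> S)"
    using S(1) c(5)[of 0] n by (simp add: splits_pair)
  ultimately show False by blast
qed


section \<open>Paths through the elements of an eardrum\<close>

lemma ends_eq:
  assumes "fin_multigraph G" "e \<in> edges G" "u \<in> ends G e" "w \<in> ends G e" "u \<noteq> w"
  shows "ends G e = {u, w}"
proof -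
  have "card (ends G e) = 2" using assms by (simp add: fin_multigraph_def)
  then obtain a b where "ends G e = {a, b}" by (auto simp: card_2_iff)
  then show ?thesis using assms by auto
qed

definition terminals :: "'v list \<times> 'e list \<Rightarrow> 'v \<times> 'v" where
  "terminals p = (hd (fst p), last (fst p))"

lemma paths_through_cases:
  assumes "p \<in> paths_through G f" "f \<noteq> {}"
  obtains a ws b es where "p = (a # ws @ [b], es)" "ws \<noteq> []" "set ws = f"
proof -
  obtain vs es where p: "p = (vs, es)" by (cases p)
  have f: "set (butlast (tl vs)) = f" using assms p by (simp add: paths_through_def internal_verts_def)
  have "vs \<noteq> []" using f assms(2) by auto
  then obtain a us where us: "vs = a # us" by (cases vs) auto
  then have "us \<noteq> []" using f assms(2) by auto
  then have "us = butlast us @ [last us]" by simp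
  then show thesis using that[of a "butlast us" "last us" es] p us f assms(2) by auto
qed

text \<open>The structural consequences of \<open>eardrum\<close> on which the argument rests. The
  assumption \<open>closed\<close> expresses that no edge joins two different elements of
  \<open>M\<close>.\<close>

locale eardrum_graph =
  fixes G :: "('v, 'e) multigraph" and M :: "'v set set"
  assumes fin: "fin_multigraph G"
    and nonempty: "f \<in> M \<Longrightarrow> f \<noteq> {}"
    and sub: "f \<in> M \<Longrightarrow> f \<subseteq> verts G"
    and disj: "f \<in> M \<Longrightarrow> g \<in> M \<Longrightarrow> f \<noteq> g \<Longrightarrow> f \<inter> g = {}"
    and at_most_two: "f \<in> M \<Longrightarrow> \<exists>u v. f = {u, v}"
    and closed: "e \<in> edges G \<Longrightarrow> f \<in> M \<Longrightarrow> u \<in> ends G e \<Longrightarrow> w \<in> ends G e \<Longrightarrow>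
      u \<in> f \<Longrightarrow> w \<in> \<Union>M \<Longrightarrow> w \<in> f"

text \<open>Degree at most 1 makes the neighbour of a vertex in the induced subgraph unique, so a
  component is a single vertex or the two ends of an edge.\<close>

lemma eardrum_graphI:
  assumes G: "fin_multigraph G" and M: "eardrum G M"
  shows "eardrum_graph G M"
proof -
  obtain U where U: "U \<subseteq> verts G" "\<And>v. v \<in> U \<Longrightarrow> vdegree (induced G U) v \<le> 1"
      "M = component_sets (induced G U)"
    using M by (auto simp: eardrum_def)
  let ?H = "induced G U"
  let ?C = "\<lambda>v. {w \<in> U. (adjacent ?H)\<^sup>*\<^sup>* v w}"
  have MC: "M = ?C ` U" using U(3) by (auto simp: component_sets_def induced_def)
  have sym: "(adjacent ?H)\<^sup>*\<^sup>* u v \<Longrightarrow> (adjacent ?H)\<^sup>*\<^sup>* v u" for u v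
  proof -
    have "symp (adjacent ?H)" by (auto simp: symp_def adjacent_def insert_commute)
    then show "(adjacent ?H)\<^sup>*\<^sup>* u v \<Longrightarrow> (adjacent ?H)\<^sup>*\<^sup>* v u" by (metis sympD symp_rtranclp)
  qed
  have adjU: "u \<in> U" "v \<in> U" if "adjacent ?H u v" for u v
    using that by (auto simp: adjacent_def induced_def)
  have unique: "v = w" if adj: "adjacent ?H u v" "adjacent ?H u w" for u v w
  proof -
    obtain e e' where e: "e \<in> edges ?H" "ends ?H e = {u, v}" "e' \<in> edges ?H" "ends ?H e' = {u, w}"
      using adj unfolding adjacent_def by blast
    have "finite {e \<in> edges ?H. u \<in> ends ?H e}"
      using G by (auto simp: fin_multigraph_def induced_def)
    then have "e = e'" using U(2)[OF adjU(1)[OF that(1)]] e card_le_Suc0_iff_eq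
      by (fastforce simp: vdegree_def)
    then show ?thesis using e by (auto simp: doubleton_eq_iff)
  qed
  show ?thesis
  proof
    show "fin_multigraph G" by fact
    show "f \<noteq> {}" "f \<subseteq> verts G" if "f \<in> M" for f using that U(1) MC by auto
    show "f \<inter> g = {}" if fg: "f \<in> M" "g \<in> M" "f \<noteq> g" for f g
    proof (rule ccontr)
      assume "f \<inter> g \<noteq> {}"
      moreover obtain u v where uv: "f = ?C u" "g = ?C v" using fg MC by blast
      ultimately obtain w where "(adjacent ?H)\<^sup>*\<^sup>* u w" "(adjacent ?H)\<^sup>*\<^sup>* v w" by blast
      then have "(adjacent ?H)\<^sup>*\<^sup>* u v" "(adjacent ?H)\<^sup>*\<^sup>* v u" using sym by (meson rtranclp_trans)+
      then have "f = g" unfolding uv by (auto intro: rtranclp_trans)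
      with fg show False by simp
    qed
    show "\<exists>u v. f = {u, v}" if f: "f \<in> M" for f
    proof -
      obtain v where v: "v \<in> U" "f = ?C v" using f MC by blast
      \<comment> \<open>\<open>w\<close> is the neighbour of \<open>v\<close> if there is one, and
        \<open>v\<close> itself otherwise; in both cases the component will be
        \<open>{v, w}\<close>.\<close>
      obtain w where w: "w \<in> ?C v" "\<And>x. adjacent ?H v x \<Longrightarrow> adjacent ?H v w"
      proof (cases "\<exists>x. adjacent ?H v x")
        case True
        then obtain x where "adjacent ?H v x" ..
        then show ?thesis using that[of x] adjU(2) by auto
      qed (use that[of v] v in auto)
      have "x \<in> {v, w}" if "(adjacent ?H)\<^sup>*\<^sup>* v x" for x
        using that
      proof induction
        case (step y z)
        have "adjacent ?H z y" using step(2) by (simp add: adjacent_def insert_commute)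
        show ?case
        proof (cases "y = v")
          case True
          then show ?thesis using step(2) w(2) unique by blast
        next
          case False
          then have "y = w" using step(3) by simp
          have "w \<noteq> v" using False \<open>y = w\<close> by simp
          have "adjacent ?H v w"
          proof -
            have "(adjacent ?H)\<^sup>*\<^sup>* v w" using w(1) by simp
            then obtain x where "adjacent ?H v x" using \<open>w \<noteq> v\<close> by (metis converse_rtranclpE)
            then show ?thesis by (rule w(2))
          qed
          then have "adjacent ?H w v" by (simp add: adjacent_def insert_commute)
          then have "z = v" using step(2) \<open>y = w\<close> unique by blast
          then show ?thesis by simp
        qed
      qed simp
      then have "f = {v, w}" using v w(1) by auto
      then show ?thesis by blast
    qed
    show "w \<in> f" if *: "e \<in> edges G" "f \<in> M" "u \<in> ends G e" "w \<in> ends G e" "u \<in> f" "w \<in> \<Union>M"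
      for e f u w
    proof (cases "u = w")
      case False
      then have e: "ends G e = {u, w}" using ends_eq[OF G] * by simp
      have "u \<in> U" "w \<in> U" using * MC by auto
      then have "adjacent ?H u w" using e * by (auto simp: adjacent_def induced_def)
      then show ?thesis using * MC \<open>w \<in> U\<close> by (auto intro: rtranclp.rtrancl_into_rtrancl)
    qed (use * in simp)
  qed
qed

context eardrum_graph
begin

abbreviation "V0 \<equiv> verts G - \<Union>M"

lemma finV: "finite (verts G)" and finE: "finite (edges G)"
  using fin by (auto simp: fin_multigraph_def)

lemma finM: "finite M"
  using finV sub by (meson Pow_iff finite_Pow_iff finite_subset subsetI)

lemma finite_f: "f \<in> M \<Longrightarrow> finite f"
  using sub finV finite_subset by blast

text \<open>A terminal is adjacent to an internal vertex. If it lay in \<open>\<Union>M\<close>,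
  then \<open>closed\<close> would place it in \<open>f\<close>, and the path would repeat a
  vertex.\<close>

lemma terminals_V0:
  assumes "f \<in> M" "p \<in> paths_through G f"
  shows "terminals p \<in> V0 \<times> V0"
proof -
  obtain a ws b es where p: "p = (a # ws @ [b], es)" "ws \<noteq> []" "set ws = f"
    using assms nonempty by (blast elim: paths_through_cases)
  let ?n = "length ws"
  have gp: "length es = Suc ?n" "distinct (a # ws @ [b])" "set (a # ws @ [b]) \<subseteq> verts G" "set es \<subseteq> edges G"
      "\<And>i. i < Suc ?n \<Longrightarrow> ends G (es ! i) = {(a # ws @ [b]) ! i, (a # ws @ [b]) ! Suc i}"
    using assms p by (auto simp: paths_through_def graph_path_def)
  have e: "es ! 0 \<in> edges G" "es ! ?n \<in> edges G" using gp by auto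
  have "ends G (es ! 0) = {a, hd ws}" using gp(5)[of 0] p(2) by (simp add: hd_append hd_conv_nth nth_append)
  moreover have "ends G (es ! ?n) = {last ws, b}"
    using gp(5)[of ?n] p(2) by (simp add: nth_append last_conv_nth nth_Cons')
  moreover have "hd ws \<in> f" "last ws \<in> f" "a \<notin> f" "b \<notin> f" using p gp by auto
  ultimately have "a \<notin> \<Union>M" "b \<notin> \<Union>M"
    using closed[OF e(1) assms(1), of "hd ws" a] closed[OF e(2) assms(1), of "last ws" b] by blast+
  then show ?thesis using p gp(3) unfolding terminals_def by simp
qed

text \<open>Replacing one terminal of a path by another neighbour of the adjacent internal vertex gives
  a path again, unless the new terminal is the other end of the path.\<close>

lemma neighbour_connected:
  assumes f: "f \<in> M" and p: "p \<in> paths_through G f"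
    and X: "terminals ` paths_through G f \<subseteq> X"
    and e: "e \<in> edges G" "u \<in> f" "u \<in> ends G e" "c \<in> ends G e" "c \<in> V0"
  shows "(hd (fst p), c) \<in> conn X"
proof -
  obtain a ws b es where pe: "p = (a # ws @ [b], es)" "ws \<noteq> []" "set ws = f"
    using f p nonempty by (blast elim: paths_through_cases)
  let ?n = "length ws"
  have gp: "length es = Suc ?n" "distinct (a # ws @ [b])" "set (a # ws @ [b]) \<subseteq> verts G" "set es \<subseteq> edges G"
      "\<And>i. i < Suc ?n \<Longrightarrow> ends G (es ! i) = {(a # ws @ [b]) ! i, (a # ws @ [b]) ! Suc i}"
    using p pe by (auto simp: paths_through_def graph_path_def)
  have "u \<noteq> c" using e f by auto
  then have ends: "ends G e = {u, c}" using ends_eq[OF fin] e by simp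
  have "c \<notin> f" using e f by auto
  have ab: "(a, b) \<in> conn X" using X p pe by (auto simp: terminals_def intro!: conn_edge)
  have upd: "set (es[i := e]) \<subseteq> edges G" for i
    using set_update_subset_insert[of es i e] gp e by auto
  \<comment> \<open>Since \<open>f\<close> has at most two elements, each internal vertex is next to
    a terminal; exchanging one end of the path is therefore enough.\<close>
  have "u = hd ws \<or> u = last ws"
  proof -
    obtain x y where xy: "f = {x, y}" using at_most_two f by blast
    have "length ws = card f" using gp pe distinct_card[of ws] by simp
    also have "\<dots> \<le> 2" using xy by (simp add: card_insert_if)
    finally have "length ws \<le> 2" .
    moreover have "0 < length ws" using pe by simp
    ultimately have "length ws = 1 \<or> length ws = 2" by linarith
    then obtain x y where "ws = [x] \<or> ws = [x, y]"
      by (auto simp: length_Suc_conv numeral_2_eq_2)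
    then show ?thesis using e pe by auto
  qed
  then show ?thesis
  proof
    assume u: "u = last ws"
    show ?thesis
    proof (cases "c = a")
      case False
      have "graph_path G (a # ws @ [c], es[?n := e])"
        unfolding graph_path_def prod.case
      proof (intro conjI allI impI)
        fix i assume "i < length (es[?n := e])"
        then consider "i = ?n" | "i < ?n" using gp by fastforce
        then show "ends G (es[?n := e] ! i) = {(a # ws @ [c]) ! i, (a # ws @ [c]) ! Suc i}"
        proof cases
          case 1
          then show ?thesis using gp ends u pe by (simp add: nth_append last_conv_nth nth_Cons')
        next
          case 2
          have "(a # ws @ [x]) ! i = (a # ws) ! i" "(a # ws @ [x]) ! Suc i = ws ! i" for x
            using 2 nth_append[of "a # ws" "[x]" i] by (simp_all add: nth_append)
          then show ?thesis using 2 gp(1) gp(5)[of i] by simp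
        qed
      qed (use False \<open>c \<notin> f\<close> gp e pe upd in auto)
      then have "(a # ws @ [c], es[?n := e]) \<in> paths_through G f"
        using pe by (simp add: paths_through_def internal_verts_def)
      then have "terminals (a # ws @ [c], es[?n := e]) \<in> X" using X by blast
      then show ?thesis using pe by (simp add: terminals_def conn_edge)
    qed (use pe in simp)
  next
    \<comment> \<open>Now the first terminal is exchanged, and the new path joins \<open>c\<close>
      to \<open>b\<close>. The original pair \<open>(a, b)\<close> leads back to \<open>a\<close>,
      and it alone settles the case \<open>c = b\<close>.\<close>
    assume u: "u = hd ws"
    show ?thesis
    proof (cases "c = b")
      case False
      have "graph_path G (c # ws @ [b], es[0 := e])"
        unfolding graph_path_def prod.case
      proof (intro conjI allI impI)
        fix i assume "i < length (es[0 := e])"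
        then consider "i = 0" | "0 < i" "i < Suc ?n" using gp by fastforce
        then show "ends G (es[0 := e] ! i) = {(c # ws @ [b]) ! i, (c # ws @ [b]) ! Suc i}"
        proof cases
          case 1
          then show ?thesis using gp ends u pe by (auto simp: nth_append hd_conv_nth)
        next
          case 2
          then show ?thesis using gp(1) gp(5)[of i] by (simp add: nth_Cons')
        qed
      qed (use False \<open>c \<notin> f\<close> gp e pe upd in auto)
      then have "(c # ws @ [b], es[0 := e]) \<in> paths_through G f"
        using pe by (simp add: paths_through_def internal_verts_def)
      then have "terminals (c # ws @ [b], es[0 := e]) \<in> X" using X by blast
      then have "(c, b) \<in> conn X" using pe by (simp add: terminals_def conn_edge)
      then have "(b, c) \<in> conn X" by (rule conn_sym)
      with ab show ?thesis using pe by (auto intro: conn_trans)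
    qed (use ab pe in simp)
  qed
qed

text \<open>An edge of the path through \<open>f\<close> is a bridge: a cut of the terminal graph that separates
  only the terminals of \<open>f\<close> extends to a cut of \<open>G\<close>, where every other \<open>g\<close> follows its
  terminals and the path through \<open>f\<close> is cut at the given edge.\<close>

lemma earmuffI:
  assumes F: "F \<subseteq> M" and P: "\<And>f. f \<in> F \<Longrightarrow> P f \<in> paths_through G f"
    and inj: "inj_on (\<lambda>f. terminals (P f)) F"
    and indep: "graphic_rank V0 ((\<lambda>f. terminals (P f)) ` F) = card F"
  shows "earmuff G M F P"
proof -
  let ?t = "\<lambda>f. terminals (P f)"
  let ?E = "\<Union>f\<in>F. path_edges (P f)"
  have "forest (spanning G ?E)"
  proof (rule forestI_bridges)
    fix e assume "e \<in> edges (spanning G ?E)"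
    then obtain f where f: "f \<in> F" "e \<in> path_edges (P f)" by (auto simp: spanning_def)
    have fM: "f \<in> M" using f F by auto
    obtain a ws b es where p: "P f = (a # ws @ [b], es)" "set ws = f"
      using P[OF f(1)] nonempty[OF fM] by (blast elim: paths_through_cases)
    define vs where "vs = a # ws @ [b]"
    have gp: "length vs = Suc (length es)" "distinct vs" "length es = Suc (length ws)"
        "\<And>i. i < length es \<Longrightarrow> ends G (es ! i) = {vs ! i, vs ! Suc i}"
      using P[OF f(1)] p by (auto simp: paths_through_def graph_path_def vs_def)
    obtain i where i: "i < length es" "e = es ! i"
      using f(2) p by (auto simp: path_edges_def in_set_conv_nth)
    have ab: "?t f = (a, b)" "a \<in> V0" "b \<in> V0"
      using terminals_V0[OF fM P[OF f(1)]] p by (auto simp: terminals_def)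
    let ?X = "?t ` F - {(a, b)}"
    \<comment> \<open>The side of \<open>a\<close> in the terminal graph after its bridge
      \<open>(a, b)\<close> has been removed.\<close>
    define S0 where "S0 = conn ?X `` {a}"
    have "(a, b) \<notin> conn ?X"
    proof (rule independent_bridge)
      show "?t ` F \<subseteq> V0 \<times> V0" using terminals_V0[OF subsetD[OF F] P] by (rule image_subsetI)
      show "graphic_rank V0 (?t ` F) = card (?t ` F)" using indep card_image[OF inj] by simp
      show "(a, b) \<in> ?t ` F" using f ab by (metis imageI)
    qed (use finV in simp)
    then have S0: "a \<in> S0" "b \<notin> S0" by (simp_all add: S0_def)
    \<comment> \<open>The edge \<open>e = es ! i\<close> joins \<open>vs ! i\<close> to
      \<open>vs ! Suc i\<close>, so the prefix of length \<open>Suc i\<close> puts exactly its first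
      end into \<open>S\<close>. Each other \<open>g\<close> is placed according to its first
      terminal.\<close>
    define S where "S = (S0 \<inter> V0) \<union> \<Union>{g \<in> F. g \<noteq> f \<and> hd (fst (P g)) \<in> S0} \<union> set (take (Suc i) vs)"
    have S_iff: "x \<in> S \<longleftrightarrow> x \<in> S0 \<inter> V0 \<or> (\<exists>g\<in>F. g \<noteq> f \<and> hd (fst (P g)) \<in> S0 \<and> x \<in> g) \<or>
        x \<in> set (take (Suc i) vs)" for x
      unfolding S_def by blast
    have in_V0: "x \<notin> g" if "x \<in> V0" "g \<in> F" for x g using that F by blast
    have apart: "x \<notin> h" if "x \<in> g" "g \<in> F" "h \<in> F" "h \<noteq> g" for x g h
      using that disj[of g h] F by blast
    have take: "vs ! j \<in> set (take (Suc i) vs) \<longleftrightarrow> j \<le> i" if "j < length vs" for j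
    proof
      assume "j \<le> i"
      then have "take (Suc i) vs ! j = vs ! j" "j < length (take (Suc i) vs)" using that by auto
      then show "vs ! j \<in> set (take (Suc i) vs)" by (metis nth_mem)
    next
      assume "vs ! j \<in> set (take (Suc i) vs)"
      then obtain k where "k < length vs" "k \<le> i" "vs ! k = vs ! j" by (auto simp: in_set_conv_nth)
      then show "j \<le> i" using that gp(2) by (simp add: nth_eq_iff_index_eq)
    qed
    \<comment> \<open>The prefix must not disturb the sides of terminals shared with other paths: it
      contains no vertex of \<open>V0\<close> except \<open>a\<close>, since \<open>b\<close> has
      index \<open>length es > i\<close>.\<close>
    have take_V0: "x = a" if "x \<in> set (take (Suc i) vs)" "x \<in> V0" for x
    proof -
      have "b = vs ! length es" using gp by (simp add: vs_def)
      then have "x \<noteq> b" using that take[of "length es"] gp i by auto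
      moreover have "x \<in> set vs" using that by (meson in_set_takeD)
      ultimately show ?thesis using that p fM by (auto simp: vs_def)
    qed
    have path_f: "vs ! j \<in> S \<longleftrightarrow> j \<le> i" if j: "j < length vs" for j
    proof (cases "j \<le> i")
      case True
      then show ?thesis using take[OF j] by (simp add: S_def)
    next
      case False
      then obtain k where k: "j = Suc k" by (cases j) auto
      have notin: "vs ! j \<notin> set (take (Suc i) vs)" using take[OF j] False by simp
      show ?thesis
      proof (cases "k < length ws")
        case True
        then have "vs ! j \<in> f" using k p by (auto simp: vs_def nth_append)
        moreover have "vs ! j \<notin> V0" using \<open>vs ! j \<in> f\<close> fM by blast
        ultimately have "vs ! j \<notin> S" unfolding S_iff using notin apart f(1) by blast
        then show ?thesis using False by simp
      next
        case F': False
        then have "vs ! j = b" using k j gp by (auto simp: vs_def nth_append nth_Cons')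
        then have "vs ! j \<notin> S" unfolding S_iff using notin S0 in_V0[OF ab(3)] by auto
        then show ?thesis using False by simp
      qed
    qed
    have path_g: "x \<in> S \<longleftrightarrow> hd (fst (P g)) \<in> S0" if g: "g \<in> F" "g \<noteq> f" "x \<in> set (fst (P g))" for g x
    proof -
      have gM: "g \<in> M" using g F by auto
      obtain c xs d ds where q: "P g = (c # xs @ [d], ds)" "set xs = g"
        using P[OF g(1)] nonempty[OF gM] by (blast elim: paths_through_cases)
      have cd: "?t g = (c, d)" "c \<in> V0" "d \<in> V0"
        using terminals_V0[OF gM P[OF g(1)]] q by (auto simp: terminals_def)
      \<comment> \<open>Injectivity keeps the terminal pair of \<open>g\<close> in
        \<open>?X\<close>, so both terminals lie on the same side of \<open>S0\<close>, and the
        interior follows them.\<close>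
      have "?t g \<noteq> ?t f" using inj g f by (auto dest: inj_onD)
      then have "(c, d) \<in> ?X" using g cd ab by (metis DiffI imageI singletonD)
      then have *: "(c, d) \<in> conn ?X" by (rule conn_edge)
      have same: "c \<in> S0 \<longleftrightarrow> d \<in> S0"
        using conn_trans[OF _ *, of a] conn_trans[OF _ conn_sym[OF *], of a] by (auto simp: S0_def)
      have V0S: "y \<in> S \<longleftrightarrow> y \<in> S0" if "y \<in> V0" for y
        unfolding S_iff using that take_V0[of y] S0 in_V0[OF that] by blast
      consider "x = c" | "x = d" | "x \<in> g" using g q by auto
      then show ?thesis
      proof cases
        case 3
        then have V0: "x \<notin> V0" using gM by blast
        have "x \<notin> f" using apart[OF 3 g(1) f(1)] g(2) by simp
        then have "x \<notin> set vs" using V0 ab p by (auto simp: vs_def)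
        then have "x \<notin> set (take (Suc i) vs)" using in_set_takeD[of x] by blast
        then show ?thesis unfolding S_iff using V0 3 g apart[OF 3 g(1)] by blast
      qed (use V0S cd same q in auto)
    qed
    show "\<exists>S. splits S (ends (spanning G ?E) e) \<and>
        (\<forall>e'\<in>edges (spanning G ?E). splits S (ends (spanning G ?E) e') \<longrightarrow> e' = e)"
    proof (intro exI[of _ S] conjI ballI impI)
      show "splits S (ends (spanning G ?E) e)"
        using gp i path_f[of i] path_f[of "Suc i"] by (simp add: spanning_def splits_pair)
    next
      fix e' assume "e' \<in> edges (spanning G ?E)" and sp: "splits S (ends (spanning G ?E) e')"
      then obtain g where g: "g \<in> F" "e' \<in> path_edges (P g)" by (auto simp: spanning_def)
      show "e' = e"
      proof (cases "g = f")
        case True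
        then obtain j where j: "j < length es" "e' = es ! j"
          using g p by (auto simp: path_edges_def in_set_conv_nth)
        then have "(j \<le> i) \<noteq> (Suc j \<le> i)"
          using sp gp path_f[of j] path_f[of "Suc j"] by (simp add: spanning_def splits_pair)
        then have "j = i" by linarith
        then show ?thesis using j i by simp
      next
        case False
        obtain us ds where q: "P g = (us, ds)" by (cases "P g")
        have gq: "length us = Suc (length ds)" "\<And>j. j < length ds \<Longrightarrow> ends G (ds ! j) = {us ! j, us ! Suc j}"
          using P[OF g(1)] q by (auto simp: paths_through_def graph_path_def)
        obtain j where j: "j < length ds" "e' = ds ! j"
          using g q by (auto simp: path_edges_def in_set_conv_nth)
        then have "us ! j \<in> S \<longleftrightarrow> us ! Suc j \<in> S"
          using path_g[OF g(1) False] q gq by simp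
        then show ?thesis using sp gq j by (simp add: spanning_def splits_pair)
      qed
    qed
  qed
  then show ?thesis using F P by (simp add: earmuff_def)
qed

section \<open>Lower bound on the maximum size of an earmuff from the rank of terminal pairs\<close>

lemma card_le_mu:
  assumes "earmuff G M F P"
  shows "card F \<le> mu G M"
  unfolding mu_def
proof (rule Max_ge)
  have "{card F |F P. earmuff G M F P} \<subseteq> card ` Pow M" by (auto simp: earmuff_def)
  then show "finite {card F |F P. earmuff G M F P}" using finM finite_subset by blast
qed (use assms in blast)

text \<open>Otherwise Rado's theorem with \<open>k = Suc (mu G M)\<close> would supply more than
  \<open>mu G M\<close> independent terminal pairs, and \<open>earmuffI\<close> would turn them into
  an earmuff that is too large.\<close>

lemma mu_min_max:
  "\<exists>M'\<subseteq>M. graphic_rank V0 (\<Union>f\<in>M'. terminals ` paths_through G f) + card (M - M') \<le> mu G M"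
proof (rule ccontr)
  assume no: "\<not> ?thesis"
  let ?A = "\<lambda>f. terminals ` paths_through G f"
  interpret rank_function "V0 \<times> V0" "graphic_rank V0"
    using finV by (intro rank_function_graphic_rank) simp
  have "\<exists>F a. F \<subseteq> M \<and> (\<forall>f\<in>F. a f \<in> ?A f) \<and> inj_on a F \<and> Suc (mu G M) \<le> card F \<and>
      graphic_rank V0 (a ` F) = card F"
  proof (rule Rado)
    show "?A f \<subseteq> V0 \<times> V0" if "f \<in> M" for f using terminals_V0[OF that] by blast
    show "Suc (mu G M) \<le> graphic_rank V0 (\<Union>(?A ` M')) + card (M - M')" if "M' \<subseteq> M" for M'
    proof -
      have "\<not> graphic_rank V0 (\<Union>(?A ` M')) + card (M - M') \<le> mu G M"
        using no that by blast
      then show ?thesis by linarith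
    qed
  qed (rule finM)
  then obtain F a where F: "F \<subseteq> M" "\<forall>f\<in>F. a f \<in> ?A f" "inj_on a F" "Suc (mu G M) \<le> card F"
      "graphic_rank V0 (a ` F) = card F"
    by (elim exE conjE)
  then have "\<forall>f\<in>F. \<exists>p. p \<in> paths_through G f \<and> a f = terminals p" by blast
  then obtain P where P: "\<And>f. f \<in> F \<Longrightarrow> P f \<in> paths_through G f" "\<And>f. f \<in> F \<Longrightarrow> a f = terminals (P f)"
    by metis
  have "earmuff G M F P"
  proof (rule earmuffI)
    show "inj_on (\<lambda>f. terminals (P f)) F" using F(3) P(2) by (simp add: inj_on_def)
    have "(\<lambda>f. terminals (P f)) ` F = a ` F" using P(2) by simp
    then show "graphic_rank V0 ((\<lambda>f. terminals (P f)) ` F) = card F" using F(5) by simp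
  qed (use F P in auto)
  then show False using card_le_mu F(4) by fastforce
qed

end

section \<open>The lower bound on the linear program\<close>

text \<open>The partition constraint for the fibres of a labelling: an edge in the cut of a fibre
  has ends with different labels. Working with labels avoids constructing blocks explicitly in the
  application.\<close>

lemma LP_partition_bound:
  assumes G: "fin_multigraph G" and x: "LP_feasible G T x"
  shows "real (card (\<kappa> ` verts G)) - 1
    \<le> sum x {e \<in> edges G. \<exists>u\<in>ends G e. \<exists>v\<in>ends G e. \<kappa> u \<noteq> \<kappa> v}" (is "_ \<le> sum x ?C")
proof -
  define fib where "fib y = {v \<in> verts G. \<kappa> v = y}" for y
  define W where "W = fib ` \<kappa> ` verts G"
  have "inj_on fib (\<kappa> ` verts G)" by (rule inj_onI) (auto simp: fib_def)
  then have "card W = card (\<kappa> ` verts G)" unfolding W_def by (rule card_image)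
  moreover have "partition_on (verts G) W"
    by (rule partition_onI) (auto simp: W_def fib_def disjnt_def)
  ultimately have "real (card (\<kappa> ` verts G)) - 1 \<le> sum x (\<Union>W\<in>W. edge_cut G W)"
    using x unfolding LP_feasible_def by metis
  also have "\<dots> \<le> sum x ?C"
  proof (rule sum_mono2)
    show "finite ?C" using G by (simp add: fin_multigraph_def)
    show "(\<Union>W\<in>W. edge_cut G W) \<subseteq> ?C"
    proof
      fix e assume "e \<in> (\<Union>W\<in>W. edge_cut G W)"
      then obtain y where e: "e \<in> edges G" "card (ends G e \<inter> fib y) = 1"
        by (auto simp: W_def edge_cut_def)
      then have c: "card (ends G e) = 2" "ends G e \<subseteq> verts G" using G by (auto simp: fin_multigraph_def)
      have "ends G e \<inter> fib y \<noteq> {}" using e(2) by force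
      then obtain u where u: "u \<in> ends G e" "u \<in> fib y" by blast
      have "ends G e \<inter> fib y \<noteq> ends G e" using e(2) c(1) by force
      then obtain v where v: "v \<in> ends G e" "v \<notin> fib y" by blast
      have "\<kappa> u \<noteq> \<kappa> v" using u v c(2) by (auto simp: fib_def)
      then show "e \<in> ?C" using e u v by blast
    qed
    show "0 \<le> x e" if "e \<in> ?C - (\<Union>W\<in>W. edge_cut G W)" for e
      using that x by (simp add: LP_feasible_def)
  qed
  finally show ?thesis .
qed

context eardrum_graph
begin

abbreviation incident :: "'v set \<Rightarrow> 'e set" where
  "incident f \<equiv> {e \<in> edges G. ends G e \<inter> f \<noteq> {}}"

text \<open>For \<open>f = {u, v}\<close> every edge is counted at most twice in the cuts of \<open>{u}\<close>, \<open>{v}\<close>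
  and \<open>{u, v}\<close>, whose total weight is at least 6.\<close>

lemma incident_bound:
  assumes x: "LP_feasible G T x" and f: "f \<in> M" "f \<inter> T = {}" "f \<noteq> verts G"
  shows "real (card f) + 1 \<le> sum x (incident f)"
proof -
  have cut: "2 \<le> sum x (edge_cut G W)" if "W \<noteq> {}" "W \<subseteq> f" for W
  proof -
    have "W \<subset> verts G" using that f sub by blast
    moreover have "W \<inter> T = {}" using that f by blast
    ultimately show ?thesis using x that(1) by (simp add: LP_feasible_def)
  qed
  obtain u v where uv: "f = {u, v}" using at_most_two f by blast
  show ?thesis
  proof (cases "u = v")
    case True
    have "card (A \<inter> {v}) = 1 \<longleftrightarrow> v \<in> A" for A by (cases "v \<in> A") auto
    then have "edge_cut G {u} = incident f" using True uv by (auto simp: edge_cut_def)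
    then show ?thesis using cut[of "{u}"] True uv by simp
  next
    case False
    have restrict: "sum x (edge_cut G W) = (\<Sum>e\<in>incident f. if e \<in> edge_cut G W then x e else 0)"
      if "W \<subseteq> f" for W
    proof -
      have "edge_cut G W \<subseteq> incident f"
      proof
        fix e assume e: "e \<in> edge_cut G W"
        then have "ends G e \<inter> W \<noteq> {}" by (auto simp: edge_cut_def)
        then show "e \<in> incident f" using e that by (auto simp: edge_cut_def)
      qed
      then have "incident f \<inter> edge_cut G W = edge_cut G W" by blast
      then show ?thesis using finE by (simp add: sum.If_cases Collect_mem_eq)
    qed
    have "6 \<le> sum x (edge_cut G {u}) + sum x (edge_cut G {v}) + sum x (edge_cut G f)"
      using cut[of "{u}"] cut[of "{v}"] cut[of f] uv by simp
    also have "\<dots> = (\<Sum>e\<in>incident f. (if e \<in> edge_cut G {u} then x e else 0) +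
        (if e \<in> edge_cut G {v} then x e else 0) + (if e \<in> edge_cut G f then x e else 0))"
      using uv by (simp add: restrict sum.distrib)
    also have "\<dots> \<le> (\<Sum>e\<in>incident f. 2 * x e)"
    proof (rule sum_mono)
      fix e assume e: "e \<in> incident f"
      \<comment> \<open>An edge in the cuts of both \<open>{u}\<close> and \<open>{v}\<close> joins
        \<open>u\<close> to \<open>v\<close> and so does not leave \<open>f\<close>.\<close>
      have "e \<notin> edge_cut G {u} \<or> e \<notin> edge_cut G {v} \<or> e \<notin> edge_cut G f"
      proof (rule ccontr)
        assume "\<not> ?thesis"
        then have "u \<in> ends G e" "v \<in> ends G e" "card (ends G e \<inter> f) = 1"
          by (auto simp: edge_cut_def card_1_singleton_iff)
        moreover from this have "ends G e \<inter> f = {u, v}" using uv by blast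
        ultimately show False using False by simp
      qed
      moreover have "0 \<le> x e" using e x by (simp add: LP_feasible_def)
      ultimately show "(if e \<in> edge_cut G {u} then x e else 0) +
        (if e \<in> edge_cut G {v} then x e else 0) + (if e \<in> edge_cut G f then x e else 0) \<le> 2 * x e"
        by auto
    qed
    also have "\<dots> = 2 * sum x (incident f)" by (simp add: sum_distrib_left)
    finally show ?thesis using False uv by simp
  qed
qed

lemma card_Union_M: "N \<subseteq> M \<Longrightarrow> card (\<Union>N) = (\<Sum>f\<in>N. card f)"
proof (rule card_Union_disjoint)
  assume N: "N \<subseteq> M"
  show "pairwise disjnt N" unfolding pairwise_def disjnt_def using N disj by blast
  show "finite f" if "f \<in> N" for f using that N finite_f by blast
qed

text \<open>If the elements of \<open>M'\<close> have all their terminals identified by \<open>conn X\<close>, then adding each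
  of them to the class of its neighbours gives a partition of the vertices (the remaining vertices
  of \<open>\<Union>M\<close> form singletons) that is not crossed by any edge incident to \<open>M'\<close>.\<close>

lemma LP_class_bound:
  assumes x: "LP_feasible G T x" and MT: "\<Union>M \<inter> T = {}"
    and paths: "\<forall>f\<in>M. paths_through G f \<noteq> {}"
    and M': "M' \<subseteq> M"
  shows "real (card (V0 // conn (\<Union>f\<in>M'. terminals ` paths_through G f))) + real (card (\<Union>M))
      + real (card M') - 1 \<le> sum x (edges G)"
proof -
  define X where "X = (\<Union>f\<in>M'. terminals ` paths_through G f)"
  define p where "p f = (SOME q. q \<in> paths_through G f)" for f
  have p: "p f \<in> paths_through G f" if "f \<in> M" for f
    using paths that by (simp add: p_def some_in_eq)
  define t where "t f = hd (fst (p f))" for f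
  have tV0: "t f \<in> V0" if "f \<in> M" for f
    using terminals_V0[OF that p[OF that]] by (auto simp: t_def terminals_def)
  \<comment> \<open>An element \<open>f\<close> of \<open>M'\<close> is absorbed into the class of
    the first terminal \<open>t f\<close> of a chosen path. The description is unambiguous because
    the elements of \<open>M\<close> are disjoint.\<close>
  define \<kappa> where "\<kappa> v = (if v \<in> \<Union>M' then conn X `` {t (THE f. f \<in> M' \<and> v \<in> f)}
      else if v \<in> \<Union>M then {v} else conn X `` {v})" for v
  have \<kappa>_f: "\<kappa> v = conn X `` {t f}" if "f \<in> M'" "v \<in> f" for f v
  proof -
    have "(THE f. f \<in> M' \<and> v \<in> f) = f" using that disj M' by (intro the_equality) blast+
    then show ?thesis using that by (auto simp: \<kappa>_def)
  qed
  have \<kappa>_V0: "\<kappa> v = conn X `` {v}" if "v \<in> V0" for v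
    using that M' by (auto simp: \<kappa>_def)
  let ?U' = "\<Union>(M - M')"
  have \<kappa>_single: "\<kappa> v = {v}" if "v \<in> ?U'" for v
  proof -
    have "v \<notin> \<Union>M'" using that disj M' by blast
    then show ?thesis using that by (auto simp: \<kappa>_def)
  qed
  let ?C = "{e \<in> edges G. \<exists>u\<in>ends G e. \<exists>v\<in>ends G e. \<kappa> u \<noteq> \<kappa> v}"
  have finU: "finite ?U'" using finM finite_f by auto
  have finite_cls: "finite (V0 // conn X)" using finV by (simp add: quotient_def)
  \<comment> \<open>Every class of \<open>V0\<close> contains a vertex of \<open>V0\<close>, so it
    differs from all singletons of vertices in \<open>?U'\<close>, and the two kinds of labels can
    be counted separately.\<close>
  have classes: "card (V0 // conn X) + card ?U' \<le> card (\<kappa> ` verts G)"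
  proof -
    have "card ?U' = card ((\<lambda>v. {v}) ` ?U')" by (simp add: card_image)
    moreover have "(V0 // conn X) \<inter> (\<lambda>v. {v}) ` ?U' = {}"
    proof -
      have "conn X `` {w} \<noteq> {v}" if "w \<in> V0" "v \<in> ?U'" for v w
      proof
        assume "conn X `` {w} = {v}"
        moreover have "w \<in> conn X `` {w}" by simp
        ultimately show False using that by auto
      qed
      then show ?thesis unfolding quotient_def by blast
    qed
    ultimately have "card (V0 // conn X) + card ?U' = card (V0 // conn X \<union> (\<lambda>v. {v}) ` ?U')"
      using finU finite_cls by (subst card_Un_disjoint) auto
    also have "V0 // conn X \<union> (\<lambda>v. {v}) ` ?U' = \<kappa> ` V0 \<union> \<kappa> ` ?U'"
      using \<kappa>_V0 \<kappa>_single by (auto simp: quotient_def image_iff)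
    also have "card \<dots> \<le> card (\<kappa> ` verts G)"
      using finV sub by (intro card_mono) auto
    finally show ?thesis .
  qed
  \<comment> \<open>The other end of such an edge is in \<open>f\<close> by \<open>closed\<close>,
    or it lies in \<open>V0\<close> and is connected to \<open>t f\<close> by
    \<open>neighbour_connected\<close>; either way it carries the label of \<open>f\<close>.\<close>
  have uncrossed: "e \<notin> ?C" if e: "e \<in> incident f" and f: "f \<in> M'" for e f
  proof -
    have fM: "f \<in> M" using f M' by auto
    obtain u where u: "u \<in> ends G e" "u \<in> f" using e by auto
    have "\<kappa> w = conn X `` {t f}" if w: "w \<in> ends G e" for w
    proof (cases "w \<in> \<Union>M")
      case True
      have "w \<in> f" using closed[OF _ fM u(1) w u(2) True] e by simp
      then show ?thesis by (rule \<kappa>_f[OF f])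
    next
      case False
      have "ends G e \<subseteq> verts G" using e fin by (simp add: fin_multigraph_def)
      then have wV: "w \<in> V0" using w False by auto
      have "(t f, w) \<in> conn X" unfolding t_def
      proof (rule neighbour_connected[OF fM p[OF fM]])
        show "terminals ` paths_through G f \<subseteq> X" using f by (auto simp: X_def)
      qed (use e u w wV in auto)
      then have "conn X `` {t f} = conn X `` {w}" by (rule equiv_class_eq[OF equiv_conn])
      then show ?thesis using \<kappa>_V0[OF wV] by simp
    qed
    then show ?thesis by auto
  qed
  have disjoint_inc: "incident f \<inter> incident g = {}" if fg: "f \<in> M'" "g \<in> M'" "f \<noteq> g" for f g
  proof (rule ccontr)
    assume "incident f \<inter> incident g \<noteq> {}"
    then obtain e u w where e: "e \<in> edges G" "u \<in> ends G e" "u \<in> f" "w \<in> ends G e" "w \<in> g" by blast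
    have "f \<in> M" "g \<in> M" using fg M' by auto
    then have "w \<in> f" using closed[of e f u w] e by blast
    then show False using disj[OF \<open>f \<in> M\<close> \<open>g \<in> M\<close> fg(3)] e by blast
  qed
  have finM': "finite M'" using M' finM finite_subset by blast
  have "real (card (V0 // conn X)) + real (card ?U') - 1 \<le> sum x ?C"
    using LP_partition_bound[OF fin x, of \<kappa>] classes by linarith
  moreover have "real (card (\<Union>M')) + real (card M') \<le> sum x (\<Union>f\<in>M'. incident f)"
  proof -
    have "real (card (\<Union>M')) + real (card M') = (\<Sum>f\<in>M'. real (card f) + 1)"
      using card_Union_M[OF M'] by (simp add: sum.distrib)
    also have "\<dots> \<le> (\<Sum>f\<in>M'. sum x (incident f))"
    proof (rule sum_mono)
      fix f assume "f \<in> M'"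
      then have fM: "f \<in> M" using M' by auto
      \<comment> \<open>A terminal outside \<open>f\<close> shows that \<open>f\<close> is a proper
        subset of the vertices, as the cut constraint for \<open>f\<close> requires.\<close>
      have "t f \<in> verts G - f" using tV0[OF fM] fM by auto
      then show "real (card f) + 1 \<le> sum x (incident f)"
        using MT fM by (intro incident_bound[OF x fM]) auto
    qed
    also have "\<dots> = sum x (\<Union>f\<in>M'. incident f)"
      using finM' finE disjoint_inc by (intro sum.UNION_disjoint[symmetric]) auto
    finally show ?thesis .
  qed
  moreover have "sum x ?C + sum x (\<Union>f\<in>M'. incident f) \<le> sum x (edges G)"
  proof -
    have "sum x ?C + sum x (\<Union>f\<in>M'. incident f) = sum x (?C \<union> (\<Union>f\<in>M'. incident f))"
    proof (rule sum.union_disjoint[symmetric])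
      show "?C \<inter> (\<Union>f\<in>M'. incident f) = {}" using uncrossed by blast
    qed (use finE finM' in auto)
    also have "\<dots> \<le> sum x (edges G)"
      using finE x by (intro sum_mono2) (auto simp: LP_feasible_def)
    finally show ?thesis .
  qed
  moreover have "card (\<Union>M) = card (\<Union>M') + card ?U'"
    using M' finM card_Union_M[of M'] card_Union_M[of "M - M'"] card_Union_M[of M]
      sum.subset_diff[OF M' finM, of card] by simp
  ultimately show ?thesis unfolding X_def by simp
qed

text \<open>For the \<open>M'\<close> of \<open>mu_min_max\<close> the number of classes is
  \<open>card V0\<close> minus the rank, hence at least
  \<open>card V0 - mu G M + card (M - M')\<close>. Substituting this into
  \<open>LP_class_bound\<close> gives exactly \<open>L_mu G M\<close>.\<close>

lemma L_mu_le_LP_feasible: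
  assumes x: "LP_feasible G T x" and MT: "\<Union>M \<inter> T = {}"
    and paths: "\<forall>f\<in>M. paths_through G f \<noteq> {}"
  shows "real_of_int (L_mu G M) \<le> sum x (edges G)"
proof -
  obtain M' where M': "M' \<subseteq> M"
      "graphic_rank V0 (\<Union>f\<in>M'. terminals ` paths_through G f) + card (M - M') \<le> mu G M"
    using mu_min_max by blast
  have "graphic_rank V0 (\<Union>f\<in>M'. terminals ` paths_through G f)
      + card (V0 // conn (\<Union>f\<in>M'. terminals ` paths_through G f)) = card V0"
    using finV by (intro graphic_rank_add) simp
  moreover have "card V0 + card (\<Union>M) = card (verts G)"
  proof -
    have "\<Union>M \<subseteq> verts G" using sub by blast
    then show ?thesis using finV card_Diff_subset[of "\<Union>M" "verts G"] card_mono[of "verts G" "\<Union>M"]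
        finite_subset[of "\<Union>M" "verts G"] by simp
  qed
  moreover have "card M' + card (M - M') = card M"
    using M'(1) finM card_Diff_subset[of M' M] card_mono[of M M'] finite_subset[of M' M] by simp
  ultimately show ?thesis
    using LP_class_bound[OF x MT paths M'(1)] M'(2) unfolding L_mu_def by simp
qed

end


section \<open>Connected T-joins are feasible\<close>

text \<open>Identifying vertices with equal labels leaves a connected graph whose edges come from
  \<open>?C\<close>. All labels form one class, so the graphic rank is at least the number of labels
  minus 1, and it is at most the number of these edges.\<close>

lemma connected_partition_bound:
  assumes H: "fin_multigraph H" "connected_graph H"
  shows "card (\<kappa> ` verts H)
    \<le> Suc (card {e \<in> edges H. \<exists>u\<in>ends H e. \<exists>v\<in>ends H e. \<kappa> u \<noteq> \<kappa> v})" (is "_ \<le> Suc (card ?C)")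
proof -
  let ?V = "\<kappa> ` verts H"
  have fin: "finite ?V" "finite ?C" using H(1) by (auto simp: fin_multigraph_def)
  have "\<forall>e\<in>edges H. \<exists>u v. ends H e = {u, v}"
    using H(1) unfolding fin_multigraph_def card_2_iff by blast
  then obtain s t where "\<forall>e\<in>edges H. ends H e = {s e, t e}" by metis
  then have st: "ends H e = {s e, t e}" if "e \<in> ?C" for e using that by simp
  \<comment> \<open>Crossing edges become pairs of labels. Different edges may yield the same pair,
    so \<open>card X\<close> is only bounded above by \<open>card ?C\<close>.\<close>
  define X where "X = (\<lambda>e. (\<kappa> (s e), \<kappa> (t e))) ` ?C"
  have "X \<subseteq> ?V \<times> ?V"
  proof
    fix y assume "y \<in> X"
    then obtain e where e: "e \<in> ?C" "y = (\<kappa> (s e), \<kappa> (t e))" unfolding X_def by blast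
    have "ends H e \<subseteq> verts H" using e(1) H(1) by (simp add: fin_multigraph_def)
    then have "s e \<in> verts H" "t e \<in> verts H" unfolding st[OF e(1)] by simp_all
    then show "y \<in> ?V \<times> ?V" unfolding e(2) by simp
  qed
  then have "graphic_rank ?V X \<le> card X" by (rule graphic_rank_le_card[OF fin(1)])
  also have "card X \<le> card ?C" unfolding X_def using fin(2) by (rule card_image_le)
  finally have rank: "graphic_rank ?V X \<le> card ?C" .
  have edge: "(\<kappa> u, \<kappa> v) \<in> conn X" if "adjacent H u v" for u v
  proof (cases "\<kappa> u = \<kappa> v")
    case False
    obtain e where e: "e \<in> edges H" "ends H e = {u, v}" using \<open>adjacent H u v\<close> by (auto simp: adjacent_def)
    then have "e \<in> ?C" using False by auto
    then have "(\<kappa> (s e), \<kappa> (t e)) \<in> X" unfolding X_def by (rule imageI)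
    then have c: "(\<kappa> (s e), \<kappa> (t e)) \<in> conn X" by (rule conn_edge)
    have "{u, v} = {s e, t e}" using st[OF \<open>e \<in> ?C\<close>] e by simp
    then consider "u = s e" "v = t e" | "u = t e" "v = s e" by (auto simp: doubleton_eq_iff)
    then show ?thesis using c conn_sym[OF c] by cases simp_all
  qed simp
  have "(\<kappa> u, \<kappa> v) \<in> conn X" if "(adjacent H)\<^sup>*\<^sup>* u v" for u v
    using that
  proof induction
    case (step v w)
    show ?case using step.IH edge[OF step.hyps(2)] by (rule conn_trans)
  qed simp
  then have "(\<kappa> u, \<kappa> v) \<in> conn X" if "u \<in> verts H" "v \<in> verts H" for u v
    using that H(2) unfolding connected_graph_def by blast
  then have all: "(a, b) \<in> conn X" if "a \<in> ?V" "b \<in> ?V" for a b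
    using that by (elim imageE) simp
  have "card (?V // conn X) \<le> Suc 0"
  proof -
    have "finite (?V // conn X)"
      unfolding quotient_def using fin(1) by (rule finite_UN_I) simp
    moreover have "A = B" if "A \<in> ?V // conn X" "B \<in> ?V // conn X" for A B
    proof -
      obtain a where a: "a \<in> ?V" "A = conn X `` {a}" using \<open>A \<in> _\<close> by (rule quotientE)
      obtain b where b: "b \<in> ?V" "B = conn X `` {b}" using \<open>B \<in> _\<close> by (rule quotientE)
      show ?thesis unfolding a(2) b(2) by (rule equiv_class_eq[OF equiv_conn all[OF a(1) b(1)]])
    qed
    ultimately show ?thesis by (simp add: card_le_Suc0_iff_eq)
  qed
  then show ?thesis using rank graphic_rank_add[OF fin(1), of X] by linarith
qed

text \<open>Double counting: the degree sum over \<open>W\<close> is even because evenly many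
  vertices of \<open>W\<close> have odd degree, and an edge contributes an odd amount to it exactly
  when one of its ends is in \<open>W\<close>.\<close>

lemma even_T_join_cut:
  assumes H: "fin_multigraph H" and F: "T_join H T F" and W: "W \<subseteq> verts H" "even (card (W \<inter> T))"
  shows "even (card {e \<in> F. card (ends H e \<inter> W) = 1})"
proof -
  have FE: "F \<subseteq> edges H" and T: "T = {v \<in> verts H. odd (card {e \<in> F. v \<in> ends H e})}"
    using F by (auto simp: T_join_def)
  have fin: "finite W" "finite F"
    using H W FE finite_subset by (auto simp: fin_multigraph_def)
  have "W \<inter> T = {v \<in> W. odd (card {e \<in> F. v \<in> ends H e})}" using T W by auto
  then have "even (\<Sum>v\<in>W. card {e \<in> F. v \<in> ends H e})" using W(2) fin by (simp add: even_sum_iff)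
  also have "(\<Sum>v\<in>W. card {e \<in> F. v \<in> ends H e}) = (\<Sum>e\<in>F. card {v \<in> W. v \<in> ends H e})"
  proof -
    have count: "card {x \<in> A. Q x} = (\<Sum>x\<in>A. if Q x then 1 else 0)"
      if "finite A" for A and Q :: "_ \<Rightarrow> bool"
      using sum.inter_filter[OF that, of "\<lambda>_. 1 :: nat" Q] by simp
    show ?thesis using fin by (simp add: count sum.swap[of _ F W])
  qed
  finally have "even (card {e \<in> F. odd (card {v \<in> W. v \<in> ends H e})})"
    using fin by (simp add: even_sum_iff)
  moreover have "odd (card {v \<in> W. v \<in> ends H e}) \<longleftrightarrow> card (ends H e \<inter> W) = 1" if "e \<in> F" for e
  proof -
    have e: "card (ends H e) = 2" using H FE that by (auto simp: fin_multigraph_def)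
    then have "finite (ends H e)" using card.infinite by fastforce
    then have "card (ends H e \<inter> W) \<le> 2" using e card_mono[of "ends H e" "ends H e \<inter> W"] by simp
    moreover have "{v \<in> W. v \<in> ends H e} = ends H e \<inter> W" by auto
    ultimately show ?thesis by (auto simp: le_Suc_eq numeral_2_eq_2)
  qed
  then have "{e \<in> F. odd (card {v \<in> W. v \<in> ends H e})} = {e \<in> F. card (ends H e \<inter> W) = 1}"
    by blast
  ultimately show ?thesis by simp
qed

text \<open>The vector counts the copies of each edge in \<open>F\<close>. For a cut with even
  \<open>W \<inter> T\<close> the count is even by parity and positive by connectedness, hence at
  least 2; the partition constraints follow from \<open>connected_partition_bound\<close>.\<close>

lemma LP_feasible_connected_T_join:
  assumes G: "fin_multigraph G" and F: "connected_T_join G T F"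
  shows "LP_feasible G T (\<lambda>e. real (card {q \<in> F. fst q = e}))" (is "LP_feasible G T ?x")
    and "(\<Sum>e\<in>edges G. real (card {q \<in> F. fst q = e})) = real (card F)"
proof -
  let ?D = "doubled G"
  let ?H = "spanning ?D F"
  have FE: "F \<subseteq> edges ?D" and J: "T_join ?D T F" and conn: "connected_graph ?H"
    using F by (auto simp: connected_T_join_def T_join_def)
  have D: "fin_multigraph ?D" using G by (auto simp: fin_multigraph_def doubled_def)
  have H: "fin_multigraph ?H" using D FE finite_subset by (auto simp: fin_multigraph_def spanning_def)
  have VH: "verts ?H = verts G" by (simp add: spanning_def doubled_def)
  have endsD: "ends ?D q = ends G (fst q)" for q by (simp add: doubled_def split: prod.split)
  have fstF: "fst q \<in> edges G" if "q \<in> F" for q using that FE by (auto simp: doubled_def)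
  have finF: "finite F" using D FE finite_subset by (auto simp: fin_multigraph_def)
  have sum_x: "sum ?x C = real (card {q \<in> F. fst q \<in> C})" if "C \<subseteq> edges G" for C
  proof -
    have "finite C" using that G finite_subset by (auto simp: fin_multigraph_def)
    have "card (\<Union>e\<in>C. {q \<in> F. fst q = e}) = (\<Sum>e\<in>C. card {q \<in> F. fst q = e})"
      using \<open>finite C\<close> finF by (intro card_UN_disjoint) auto
    moreover have "(\<Union>e\<in>C. {q \<in> F. fst q = e}) = {q \<in> F. fst q \<in> C}" by auto
    ultimately show ?thesis by simp
  qed
  have "{q \<in> F. fst q \<in> edges G} = F" using fstF by auto
  then show "sum ?x (edges G) = real (card F)" using sum_x[of "edges G"] by simp
  have cut: "{q \<in> F. fst q \<in> edge_cut G W} = {q \<in> F. card (ends ?D q \<inter> W) = 1}" for W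
    using fstF by (auto simp: edge_cut_def endsD)
  show "LP_feasible G T ?x"
    unfolding LP_feasible_def
  proof (intro conjI ballI allI impI)
    fix W assume W: "W \<noteq> {} \<and> W \<subset> verts G \<and> even (card (W \<inter> T))"
    let ?C = "{q \<in> F. card (ends ?D q \<inter> W) = 1}"
    have "even (card ?C)"
      using W by (intro even_T_join_cut[OF D J]) (auto simp: doubled_def)
    moreover have "edge_cut ?H W \<noteq> {}" using W VH by (intro cut_nonempty[OF H conn]) auto
    then have "?C \<noteq> {}" by (simp add: edge_cut_def spanning_def)
    then have "0 < card ?C" using finF by (simp add: card_gt_0_iff)
    ultimately have "2 \<le> card ?C" by (auto elim!: evenE)
    moreover have "edge_cut G W \<subseteq> edges G" by (auto simp: edge_cut_def)
    ultimately show "2 \<le> sum ?x (edge_cut G W)" using sum_x cut by simp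
  next
    fix P assume P: "partition_on (verts G) P"
    \<comment> \<open>The label of a vertex is its block, so the labels are exactly the members of
      \<open>P\<close>.\<close>
    define \<kappa> where "\<kappa> v = (THE W. W \<in> P \<and> v \<in> W)" for v
    have \<kappa>: "\<kappa> v = W" if "W \<in> P" "v \<in> W" for v W
      unfolding \<kappa>_def using that partition_onD2[OF P]
      by (intro the_equality) (auto dest: disjointD)
    have "\<kappa> ` verts G = P"
    proof
      show "\<kappa> ` verts G \<subseteq> P" using \<kappa> partition_onD1[OF P] by auto
      show "P \<subseteq> \<kappa> ` verts G"
      proof
        fix W assume "W \<in> P"
        moreover then obtain v where "v \<in> W" using partition_onD3[OF P] by (metis ex_in_conv)
        ultimately show "W \<in> \<kappa> ` verts G" using \<kappa> partition_onD1[OF P] by blast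
      qed
    qed
    let ?C = "{q \<in> edges ?H. \<exists>u\<in>ends ?H q. \<exists>v\<in>ends ?H q. \<kappa> u \<noteq> \<kappa> v}"
    let ?K = "\<Union>W\<in>P. edge_cut G W"
    have "?C \<subseteq> {q \<in> F. fst q \<in> ?K}"
    proof
      fix q assume "q \<in> ?C"
      then obtain u v where q: "q \<in> F" "u \<in> ends G (fst q)" "v \<in> ends G (fst q)" "\<kappa> u \<noteq> \<kappa> v"
        unfolding spanning_def by (auto simp: endsD)
      then have e: "ends G (fst q) = {u, v}" using ends_eq[OF G fstF] by blast
      have "u \<in> verts G" using q(2) fstF[OF q(1)] G by (auto simp: fin_multigraph_def)
      then obtain W where W: "W \<in> P" "u \<in> W" using partition_onD1[OF P] by blast
      then have "v \<notin> W" using q(4) \<kappa> by blast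
      then have "ends G (fst q) \<inter> W = {u}" using e W by auto
      then have "fst q \<in> edge_cut G W" using fstF q(1) by (simp add: edge_cut_def)
      then show "q \<in> {q \<in> F. fst q \<in> ?K}" using q(1) W by auto
    qed
    then have "card ?C \<le> card {q \<in> F. fst q \<in> ?K}" using finF by (intro card_mono) auto
    moreover have "card P \<le> Suc (card ?C)"
      using connected_partition_bound[OF H conn, of \<kappa>] VH \<open>\<kappa> ` verts G = P\<close> by simp
    moreover have "?K \<subseteq> edges G" by (auto simp: edge_cut_def)
    ultimately show "real (card P) - 1 \<le> sum ?x ?K" using sum_x[of ?K] by simp
  qed simp
qed

theorem theorem18:
  fixes G :: "('v, 'e) multigraph" and T :: "'v set" and M :: "'v set set"
  assumes "fin_multigraph G" and "connected_graph G"
    and "T \<subseteq> verts G" and "even (card T)"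
    and "eardrum G M"
    and "\<Union>M \<inter> T = {}"
    and "\<forall>f\<in>M. paths_through G f \<noteq> {}"
  shows "real_of_int (L_mu G M) \<le> LP G T
    \<and> (\<forall>F. connected_T_join G T F \<longrightarrow> L_mu G M \<le> int (card F))"
proof -
  interpret eardrum_graph G M using assms(1,5) by (rule eardrum_graphI)
  \<comment> \<open>This bound is applied twice: to a minimiser of the linear program, and to the
    multiplicity vector of a connected \<open>T\<close>-join.\<close>
  have bound: "real_of_int (L_mu G M) \<le> sum x (edges G)" if "LP_feasible G T x" for x
    using that assms(6,7) by (rule L_mu_le_LP_feasible)
  have "real_of_int (L_mu G M) \<le> LP G T"
    using LP_attained[OF assms(1,2), of T] bound by metis
  moreover have "L_mu G M \<le> int (card F)" if "connected_T_join G T F" for F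
    using bound[OF LP_feasible_connected_T_join(1)[OF assms(1) that]]
      LP_feasible_connected_T_join(2)[OF assms(1) that] by linarith
  ultimately show ?thesis by blast
qed

end
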